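(* Consider the sequence of binary classification problems indexed by $m$ described in the context. There exists an asymptotically consistent classifier $\phi=\{\phi_m\}_{m\ge1}$ if and only if $$m=o\big(\min\{N^2,\,Nn\}\big)\qquad (m\to\infty).$$
   Context: For each integer $m\ge1$ let $[m]=\{1,\dots,m\}$ be the alphabet. The sample sizes $N=N(m)$ and $n=n(m)$ are positive integers with $N,n\to\infty$ as $m\to\infty$. Fix constants $\varepsilon>0$ and $\bar c>0$ (a large positive constant). Let $\mathcal P_m$ be the set of pairs $(\pi,\mu)$ of probability distributions on $[m]$ with $\|\mu-\pi\|_1\ge\varepsilon$, $\max_j\pi_j\le \bar c/m$ and $\max_j\mu_j\le\bar c/m$. Two training sequences $X=(X_1,\dots,X_N)$ i.i.d. with marginal $\pi$ and $Y=(Y_1,\dots,Y_N)$ i.i.d. with marginal $\mu$, and a test sequence $Z=(Z_1,\dots,Z_n)$ i.i.d. with marginal $\nu$ are observed, the three sequences being independent; $\mathsf P_{(\pi,\mu,\nu)}$ denotes the corresponding probability. Under the null hypothesis $\nu=\pi$, under the alternative $\nu=\mu$. A classifier is a sequence $\phi=\{\phi_m\}$ of functions $\phi_m:[m]^N\times[m]^N\times[m]^n\to\{0,1\}$ (output $1$ means deciding the alternative). Its worst-case average probability of error is $$P_e(\phi_m)=\sup_{(\pi,\mu)\in\mathcal P_m}\Big[\tfrac12\mathsf P_{(\pi,\mu,\pi)}\{\phi_m=1\}+\tfrac12\mathsf P_{(\pi,\mu,\mu)}\{\phi_m=0\}\Big].$$ The classifier is asymptotically consistent if $\lim_{m\t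o\infty}P_e(\phi_m)=0$.
   Formalization: The theorem is proved for 0<ε<2 and every c̄ at least some threshold depending only on ε ("large"); for ε>2 the set P_m is empty, and for ε=2 (disjoint supports) the equivalence fails, e.g. N=⌊√m⌋, n=m. *)

theory Defs
  imports "HOL-Analysis.Analysis" "HOL-Library.Landau_Symbols"
begin

definition seqs :: "nat \<Rightarrow> nat \<Rightarrow> (nat \<Rightarrow> nat) set" where
  "seqs m L = PiE {0..<L} (\<lambda>_. {1..m})"

definition is_dist :: "nat \<Rightarrow> (nat \<Rightarrow> real) \<Rightarrow> bool" where
  "is_dist m p \<longleftrightarrow> (\<forall>j\<in>{1..m}. 0 \<le> p j) \<and> (\<Sum>j=1..m. p j) = 1"

definition admissible :: "real \<Rightarrow> real \<Rightarrow> nat \<Rightarrow> (nat \<Rightarrow> real) \<Rightarrow> (nat \<Rightarrow> real) \<Rightarrow> bool" where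
  "admissible eps cbar m pd qd \<longleftrightarrow>
     is_dist m pd \<and> is_dist m qd \<and> (\<Sum>j=1..m. \<bar>qd j - pd j\<bar>) \<ge> eps \<and>
     (\<forall>j\<in>{1..m}. pd j \<le> cbar / real m \<and> qd j \<le> cbar / real m)"

definition prob3 :: "nat \<Rightarrow> nat \<Rightarrow> nat \<Rightarrow> (nat \<Rightarrow> real) \<Rightarrow> (nat \<Rightarrow> real) \<Rightarrow> (nat \<Rightarrow> real)
    \<Rightarrow> ((nat \<Rightarrow> nat) \<Rightarrow> (nat \<Rightarrow> nat) \<Rightarrow> (nat \<Rightarrow> nat) \<Rightarrow> bool) \<Rightarrow> real" where
  "prob3 m N n pd qd rd E =
     (\<Sum>x\<in>seqs m N. \<Sum>y\<in>seqs m N. \<Sum>z\<in>seqs m n.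
        if E x y z then (\<Prod>i<N. pd (x i)) * (\<Prod>i<N. qd (y i)) * (\<Prod>i<n. rd (z i)) else 0)"

text \<open>Worst-case average error of phi_m (phi m x y z = True means deciding the alternative).\<close>
definition Pe :: "real \<Rightarrow> real \<Rightarrow> (nat \<Rightarrow> nat) \<Rightarrow> (nat \<Rightarrow> nat)
    \<Rightarrow> (nat \<Rightarrow> (nat \<Rightarrow> nat) \<Rightarrow> (nat \<Rightarrow> nat) \<Rightarrow> (nat \<Rightarrow> nat) \<Rightarrow> bool) \<Rightarrow> nat \<Rightarrow> real" where
  "Pe eps cbar N n phi m =
     (SUP pm \<in> {(pd, qd). admissible eps cbar m pd qd}.
        (1/2) * prob3 m (N m) (n m) (fst pm) (snd pm) (fst pm) (phi m)
      + (1/2) * prob3 m (N m) (n m) (fst pm) (snd pm) (snd pm) (\<lambda>x y z. \<not> phi m x y z))"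

definition asymp_consistent :: "real \<Rightarrow> real \<Rightarrow> (nat \<Rightarrow> nat) \<Rightarrow> (nat \<Rightarrow> nat)
    \<Rightarrow> (nat \<Rightarrow> (nat \<Rightarrow> nat) \<Rightarrow> (nat \<Rightarrow> nat) \<Rightarrow> (nat \<Rightarrow> nat) \<Rightarrow> bool) \<Rightarrow> bool" where
  "asymp_consistent eps cbar N n phi \<longleftrightarrow> (Pe eps cbar N n phi \<longlonglongrightarrow> 0)"

end

theory Submission
  imports Defs
begin

text \<open>
  Sufficiency. Cut each training sequence into two halves \<open>X', X''\<close> and \<open>Y', Y''\<close> and use the sign of
  the inner product of the empirical distributions \<open>X' - Y'\<close> and \<open>X'' + Y'' - 2 Z\<close>.
  Its mean is \<open>\<mp>\<parallel>p - q\<parallel>\<^sup>2\<close>, of modulus at least \<open>eps\<^sup>2 / m\<close> by Cauchy-Schwarz, and its variance,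
  computed by conditioning on \<open>X'', Y'', Z\<close>, is of order
  \<open>(m / N\<^sup>2 + m / (N n) + 1 / N + 1 / n) / m\<^sup>2\<close>. Chebyshev's inequality concludes.

  Necessity. Partition the alphabet into \<open>s\<close> blocks of equal size \<open>k\<close>, and consider the uniform distributions
  \<open>p\<^sub>f\<close> on sets consisting of one letter \<open>f b\<close> from each block \<open>b\<close>, with \<open>f\<close> chosen uniformly at random.
  If \<open>N\<^sup>2 = O(m)\<close>, compare the pair \<open>(u, p\<^sub>f)\<close> under the null with the pair \<open>(p\<^sub>f, u)\<close> under the
  alternative, \<open>u\<close> being uniform: the test sequence carries no information, and with probability
  bounded below the letters of \<open>X\<close>, and those of \<open>Y\<close>, lie in pairwise distinct blocks, where both
  mixtures have the same likelihood.
  If \<open>N n = O(m)\<close>, take \<open>k = 2\<close> and the pair \<open>(p\<^sub>f, p\<^sub>1\<^sub>-\<^sub>f)\<close>: with probability bounded below no block of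
  the test sequence is seen in training, and then \<open>Z\<close> has the same likelihood under both hypotheses.
\<close>

section \<open>Expectations under product distributions\<close>

definition expect :: "nat \<Rightarrow> nat set \<Rightarrow> (nat \<Rightarrow> real) \<Rightarrow> ((nat \<Rightarrow> nat) \<Rightarrow> real) \<Rightarrow> real" where
  "expect m I p g = (\<Sum>x\<in>PiE I (\<lambda>_. {1..m}). (\<Prod>i\<in>I. p (x i)) * g x)"

definition mean :: "nat \<Rightarrow> (nat \<Rightarrow> real) \<Rightarrow> (nat \<Rightarrow> real) \<Rightarrow> real" where
  "mean m p g = (\<Sum>j=1..m. p j * g j)"

lemma expect_cong:
  assumes "\<And>x. x \<in> PiE I (\<lambda>_. {1..m}) \<Longrightarrow> g x = h x"
  shows "expect m I p g = expect m I p h"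
  unfolding expect_def using assms by (intro sum.cong) auto

lemma expect_mono:
  assumes "is_dist m p" "\<And>x. x \<in> PiE I (\<lambda>_. {1..m}) \<Longrightarrow> g x \<le> h x"
  shows "expect m I p g \<le> expect m I p h"
  unfolding expect_def using assms
  by (intro sum_mono mult_left_mono prod_nonneg) (auto simp: is_dist_def)

lemma expect_add: "expect m I p (\<lambda>x. g x + h x) = expect m I p g + expect m I p h"
  by (simp add: expect_def distrib_left sum.distrib)

lemma expect_cmult: "expect m I p (\<lambda>x. c * g x) = c * expect m I p g"
  unfolding expect_def sum_distrib_left by (simp add: mult_ac)

lemma expect_multc: "expect m I p (\<lambda>x. g x * c) = expect m I p g * c"
  using expect_cmult[of m I p c g] by (simp add: mult_ac)

lemma expect_sum: "expect m I p (\<lambda>x. \<Sum>j\<in>J. g j x) = (\<Sum>j\<in>J. expect m I p (g j))"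
  unfolding expect_def by (subst sum.swap) (simp add: sum_distrib_left)

text \<open>Expanding a product of sums over letters gives a sum over words; this is the
  independence of the coordinates.\<close>

lemma expect_prod:
  assumes "finite I"
  shows "expect m I p (\<lambda>x. \<Prod>i\<in>I. g (x i)) = mean m p g ^ card I"
proof -
  have "mean m p g ^ card I = (\<Prod>i\<in>I. \<Sum>j=1..m. p j * g j)"
    by (simp add: mean_def)
  also have "\<dots> = expect m I p (\<lambda>x. \<Prod>i\<in>I. g (x i))"
    using assms by (subst prod_sum_PiE) (auto simp: expect_def prod.distrib)
  finally show ?thesis by simp
qed

lemma mean_const: "is_dist m p \<Longrightarrow> mean m p (\<lambda>_. c) = c"
  by (simp add: mean_def is_dist_def flip: sum_distrib_right)

lemma expect_const:
  assumes "is_dist m p" "finite I"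
  shows "expect m I p (\<lambda>_. c) = c"
proof -
  have "expect m I p (\<lambda>_. 1) = 1"
    using expect_prod[OF assms(2), of m p "\<lambda>_. 1"] assms by (simp add: mean_const)
  then show ?thesis using expect_cmult[of m I p c "\<lambda>_. 1"] by simp
qed

lemma expect_swap:
  "expect m I p (\<lambda>x. expect m J q (\<lambda>y. g x y)) = expect m J q (\<lambda>y. expect m I p (\<lambda>x. g x y))"
  unfolding expect_def sum_distrib_left
  by (subst sum.swap) (simp add: mult_ac)

text \<open>Gluing words on disjoint index sets is a bijection under which the product weight
  factors: Fubini for two independent parts of one sample.\<close>

lemma expect_split:
  assumes "finite I" "finite J" "I \<inter> J = {}"
  shows "expect m (I \<union> J) p (\<lambda>x. g (restrict x I) (restrict x J))
       = expect m I p (\<lambda>x. expect m J p (\<lambda>y. g x y))"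
proof -
  have "expect m I p (\<lambda>x. expect m J p (\<lambda>y. g x y)) =
    (\<Sum>(x, y)\<in>PiE I (\<lambda>_. {1..m}) \<times> PiE J (\<lambda>_. {1..m}).
       (\<Prod>i\<in>I. p (x i)) * (\<Prod>i\<in>J. p (y i)) * g x y)"
    by (simp add: expect_def sum_distrib_left mult_ac flip: sum.cartesian_product)
  also have "\<dots> = expect m (I \<union> J) p (\<lambda>x. g (restrict x I) (restrict x J))"
    unfolding expect_def
  proof (rule sum.reindex_bij_witness
      [where j = "\<lambda>(x, y) i. if i \<in> I then x i else y i"
         and i = "\<lambda>x. (restrict x I, restrict x J)"])
    fix a assume "a \<in> PiE I (\<lambda>_. {1..m}) \<times> PiE J (\<lambda>_. {1..m})"
    then obtain x y where a: "a = (x, y)" "x \<in> PiE I (\<lambda>_. {1..m})" "y \<in> PiE J (\<lambda>_. {1..m})"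
      by auto
    let ?w = "\<lambda>i. if i \<in> I then x i else y i"
    have 1: "restrict ?w I = x" using a by (auto simp: restrict_def fun_eq_iff PiE_def extensional_def)
    have 2: "restrict ?w J = y"
      using a assms(3) by (auto simp: restrict_def fun_eq_iff PiE_def extensional_def)
    have "(\<Prod>i\<in>I. p (?w i)) = (\<Prod>i\<in>I. p (x i))" by simp
    moreover have "(\<Prod>i\<in>J. p (?w i)) = (\<Prod>i\<in>J. p (y i))"
      using assms(3) by (intro prod.cong) auto
    ultimately have 3: "(\<Prod>i\<in>I \<union> J. p (?w i)) = (\<Prod>i\<in>I. p (x i)) * (\<Prod>i\<in>J. p (y i))"
      using assms by (simp add: prod.union_disjoint)
    show "(restrict ((\<lambda>(x, y) i. if i \<in> I then x i else y i) a) I,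
           restrict ((\<lambda>(x, y) i. if i \<in> I then x i else y i) a) J) = a"
      using a 1 2 by simp
    show "(\<lambda>(x, y) i. if i \<in> I then x i else y i) a \<in> PiE (I \<union> J) (\<lambda>_. {1..m})"
      using a by (auto simp: PiE_iff extensional_def)
    show "(\<Prod>i\<in>I \<union> J. p (((\<lambda>(x, y) i. if i \<in> I then x i else y i) a) i)) *
         g (restrict ((\<lambda>(x, y) i. if i \<in> I then x i else y i) a) I)
           (restrict ((\<lambda>(x, y) i. if i \<in> I then x i else y i) a) J) =
         (case a of (x, y) \<Rightarrow> (\<Prod>i\<in>I. p (x i)) * (\<Prod>i\<in>J. p (y i)) * g x y)"
      using a 1 2 3 by simp
  next
    fix x assume x: "x \<in> PiE (I \<union> J) (\<lambda>_. {1..m})"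
    show "(\<lambda>(x, y) i. if i \<in> I then x i else y i) (restrict x I, restrict x J) = x"
      using x by (auto simp: restrict_def fun_eq_iff PiE_def extensional_def)
    show "(restrict x I, restrict x J) \<in> PiE I (\<lambda>_. {1..m}) \<times> PiE J (\<lambda>_. {1..m})"
      using x by (auto simp: PiE_iff)
  qed
  finally show ?thesis by simp
qed

text \<open>Integrating one coordinate out first is the induction step of the moment computations
  and of the birthday bound \<open>expect_inj_blocks\<close>.\<close>

lemma expect_insert:
  assumes "finite I" "i \<notin> I"
  shows "expect m (insert i I) p g = expect m I p (\<lambda>x. mean m p (\<lambda>j. g (x(i := j))))"
proof -
  have inj: "inj_on (\<lambda>(j, x). x(i := j)) ({1..m} \<times> PiE I (\<lambda>_. {1..m}))"
    using assms inj_combinator[of i I "\<lambda>_. {1..m}"] by simp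
  have pr: "(\<Prod>i'\<in>I. p ((x(i := j)) i')) = (\<Prod>i'\<in>I. p (x i'))" for x j
    using assms by (intro prod.cong) auto
  have "expect m (insert i I) p g = (\<Sum>(j, x)\<in>{1..m} \<times> PiE I (\<lambda>_. {1..m}).
      (\<Prod>i'\<in>insert i I. p ((x(i := j)) i')) * g (x(i := j)))"
    unfolding expect_def PiE_insert_eq
    using inj by (subst sum.reindex) (simp_all only: comp_def case_prod_unfold)
  also have "\<dots> = (\<Sum>j=1..m. \<Sum>x\<in>PiE I (\<lambda>_. {1..m}). (\<Prod>i'\<in>I. p (x i')) * (p j * g (x(i := j))))"
    using assms pr by (simp add: sum.cartesian_product mult_ac del: fun_upd_apply) (simp add: mult_ac)
  also have "\<dots> = expect m I p (\<lambda>x. mean m p (\<lambda>j. g (x(i := j))))"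
    unfolding expect_def mean_def sum_distrib_left by (rule sum.swap)
  finally show ?thesis .
qed

section \<open>Moments of sums and averages of i.i.d. letters\<close>

lemma expect_sum_coord:
  assumes "is_dist m p" "finite I"
  shows "expect m I p (\<lambda>x. \<Sum>i\<in>I. g (x i)) = card I * mean m p g"
  using assms(2)
proof (induction I rule: finite_induct)
  case empty
  then show ?case by (simp add: expect_def)
next
  case (insert i I)
  have *: "(\<Sum>i'\<in>insert i I. g ((x(i := j)) i')) = g j + (\<Sum>i'\<in>I. g (x i'))" for x j
  proof -
    have "(\<Sum>i'\<in>I. g ((x(i := j)) i')) = (\<Sum>i'\<in>I. g (x i'))"
      using insert by (intro sum.cong) auto
    then show ?thesis using insert by simp
  qed
  have mn: "mean m p (\<lambda>j. g j + c) = mean m p g + c" for c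
    using assms(1) mean_const[of m p c] by (simp add: mean_def distrib_left sum.distrib)
  have "expect m (insert i I) p (\<lambda>x. \<Sum>i\<in>insert i I. g (x i)) = mean m p g + expect m I p (\<lambda>x. \<Sum>i\<in>I. g (x i))"
    unfolding expect_insert[OF insert(1,2)] * mn expect_add expect_const[OF assms(1) insert(1)] ..
  then show ?case using insert by (simp add: algebra_simps)
qed

text \<open>The two terms come from the diagonal and the off-diagonal pairs of indices.\<close>

lemma expect_sum_coord_square:
  assumes "is_dist m p" "finite I"
  shows "expect m I p (\<lambda>x. (\<Sum>i\<in>I. g (x i))\<^sup>2) =
    card I * mean m p (\<lambda>j. (g j)\<^sup>2) + card I * (real (card I) - 1) * (mean m p g)\<^sup>2"
  using assms(2)
proof (induction I rule: finite_induct)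
  case empty
  then show ?case by (simp add: expect_def)
next
  case (insert i I)
  have *: "(\<Sum>i'\<in>insert i I. g ((x(i := j)) i')) = g j + (\<Sum>i'\<in>I. g (x i'))" for x j
  proof -
    have "(\<Sum>i'\<in>I. g ((x(i := j)) i')) = (\<Sum>i'\<in>I. g (x i'))"
      using insert by (intro sum.cong) auto
    then show ?thesis using insert by simp
  qed
  have "mean m p (\<lambda>j. (g j + c)\<^sup>2) = mean m p (\<lambda>j. (g j)\<^sup>2) + 2 * mean m p g * c + c\<^sup>2" for c
    using mean_const[OF assms(1), of "c\<^sup>2"]
    by (simp add: mean_def power2_sum distrib_left sum.distrib sum_distrib_left sum_distrib_right mult_ac)
  then have "expect m (insert i I) p (\<lambda>x. (\<Sum>i\<in>insert i I. g (x i))\<^sup>2) =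
    mean m p (\<lambda>j. (g j)\<^sup>2) + 2 * mean m p g * (card I * mean m p g)
     + expect m I p (\<lambda>x. (\<Sum>i\<in>I. g (x i))\<^sup>2)"
    unfolding expect_insert[OF insert(1,2)] *
    by (simp only: expect_add expect_cmult expect_const[OF assms(1) insert(1)] expect_sum_coord[OF assms(1) insert(1)])
  then show ?case using insert by (simp add: algebra_simps power2_eq_square)
qed

definition avg :: "nat set \<Rightarrow> (nat \<Rightarrow> real) \<Rightarrow> (nat \<Rightarrow> nat) \<Rightarrow> real" where
  "avg I g x = (\<Sum>i\<in>I. g (x i)) / card I"

lemma expect_avg_square:
  assumes "is_dist m p" "finite I" "I \<noteq> {}"
  shows "expect m I p (\<lambda>x. (avg I g x)\<^sup>2) \<le> mean m p (\<lambda>j. (g j)\<^sup>2) / card I + (mean m p g)\<^sup>2"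
proof -
  have c: "card I > 0" using assms by (simp add: card_gt_0_iff)
  have "expect m I p (\<lambda>x. (avg I g x)\<^sup>2) = expect m I p (\<lambda>x. (\<Sum>i\<in>I. g (x i))\<^sup>2) / (card I)\<^sup>2"
    using expect_multc[of m I p _ "1 / (card I)\<^sup>2"] by (simp add: avg_def power_divide)
  also have "\<dots> = mean m p (\<lambda>j. (g j)\<^sup>2) / card I + (1 - 1 / card I) * (mean m p g)\<^sup>2"
    unfolding expect_sum_coord_square[OF assms(1,2)]
    using c by (simp add: field_simps power2_eq_square)
  also have "\<dots> \<le> mean m p (\<lambda>j. (g j)\<^sup>2) / card I + (mean m p g)\<^sup>2"
    using c by (simp add: algebra_simps)
  finally show ?thesis .
qed

lemma mean_diff_const: "is_dist m p \<Longrightarrow> mean m p (\<lambda>j. g j - e) = mean m p g - e"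
  by (simp add: mean_def is_dist_def right_diff_distrib sum_subtractf flip: sum_distrib_right)

lemma mean_square_diff_const:
  assumes "is_dist m p"
  shows "mean m p (\<lambda>j. (g j - e)\<^sup>2) = mean m p (\<lambda>j. (g j)\<^sup>2) - 2 * e * mean m p g + e\<^sup>2"
proof -
  have "mean m p (\<lambda>j. (g j - e)\<^sup>2) =
      mean m p (\<lambda>j. (g j)\<^sup>2) - 2 * e * mean m p g + e\<^sup>2 * (\<Sum>j=1..m. p j)"
    by (simp add: mean_def power2_diff algebra_simps sum.distrib sum_subtractf sum_distrib_left)
  then show ?thesis using assms by (simp add: is_dist_def)
qed

text \<open>Centring \<open>g\<close> makes the squared mean in \<open>expect_avg_square\<close>
  vanish and does not increase the second moment of \<open>g\<close>.\<close>

lemma expect_avg_variance: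
  assumes "is_dist m p" "finite I" "I \<noteq> {}"
  shows "expect m I p (\<lambda>x. (avg I g x - mean m p g)\<^sup>2) \<le> mean m p (\<lambda>j. (g j)\<^sup>2) / card I"
proof -
  have c: "card I > 0" using assms by (simp add: card_gt_0_iff)
  let ?e = "mean m p g"
  let ?g = "\<lambda>j. g j - ?e"
  have a: "avg I g x - ?e = avg I ?g x" for x
    using c by (simp add: avg_def sum_subtractf field_simps)
  have "mean m p (\<lambda>j. (?g j)\<^sup>2) \<le> mean m p (\<lambda>j. (g j)\<^sup>2)"
    unfolding mean_square_diff_const[OF assms(1)] by (simp add: power2_eq_square[of ?e])
  moreover have "expect m I p (\<lambda>x. (avg I ?g x)\<^sup>2) \<le> mean m p (\<lambda>j. (?g j)\<^sup>2) / card I"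
    using expect_avg_square[OF assms, of ?g] mean_diff_const[OF assms(1), of g ?e] by simp
  ultimately show ?thesis unfolding a
    by (smt (verit) divide_right_mono of_nat_0_le_iff)
qed

section \<open>The split-sample statistic\<close>

text \<open>Writing an empirical frequency as the average of an indicator makes the moment bounds
  for \<open>avg\<close> apply to it.\<close>

abbreviation emp :: "nat set \<Rightarrow> (nat \<Rightarrow> nat) \<Rightarrow> nat \<Rightarrow> real" where
  "emp I x j \<equiv> avg I (\<lambda>a. of_bool (a = j)) x"

text \<open>Exchanging letters and sample positions in the double sum turns integration against the
  empirical measure into a sample average.\<close>

lemma sum_mult_emp:
  assumes "x \<in> PiE I (\<lambda>_. {1..m})"
  shows "(\<Sum>j=1..m. w j * emp I x j) = avg I w x"
proof -
  have "(\<Sum>j=1..m. w j * emp I x j) = (\<Sum>j=1..m. \<Sum>i\<in>I. w j * of_bool (x i = j)) / card I"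
    by (simp add: avg_def sum_divide_distrib sum_distrib_left)
  also have "(\<Sum>j=1..m. \<Sum>i\<in>I. w j * of_bool (x i = j)) = (\<Sum>i\<in>I. \<Sum>j=1..m. w j * of_bool (x i = j))"
    by (rule sum.swap)
  also have "\<dots> = (\<Sum>i\<in>I. w (x i))"
  proof (rule sum.cong[OF refl])
    fix i assume "i \<in> I"
    then have "x i \<in> {1..m}" using assms by auto
    moreover have "w j * of_bool (x i = j) = (if x i = j then w j else 0)" for j by simp
    ultimately show "(\<Sum>j=1..m. w j * of_bool (x i = j)) = w (x i)" by simp
  qed
  finally show ?thesis by (simp add: avg_def)
qed

text \<open>For each letter the second moment is at most
  \<open>p j / card I + (p j)\<^sup>2\<close>, and \<open>p j \<le> b\<close> makes the squares sum
  to at most \<open>b\<close>.\<close>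

lemma expect_sum_emp_square:
  assumes "is_dist m p" "\<And>j. j \<in> {1..m} \<Longrightarrow> p j \<le> b" "finite I" "I \<noteq> {}"
  shows "expect m I p (\<lambda>x. \<Sum>j=1..m. (emp I x j)\<^sup>2) \<le> 1 / card I + b"
proof -
  have p0: "p j \<ge> 0" if "j \<in> {1..m}" for j using assms(1) that by (simp add: is_dist_def)
  have one: "(\<Sum>j=1..m. p j) = 1" using assms(1) by (simp add: is_dist_def)
  have mn: "mean m p (\<lambda>a. of_bool (a = j)) = p j" if "j \<in> {1..m}" for j
  proof -
    have "p a * of_bool (a = j) = (if a = j then p a else 0)" for a by simp
    then show ?thesis using that by (simp add: mean_def)
  qed
  have "expect m I p (\<lambda>x. \<Sum>j=1..m. (emp I x j)\<^sup>2) = (\<Sum>j=1..m. expect m I p (\<lambda>x. (emp I x j)\<^sup>2))"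
    by (rule expect_sum)
  also have "\<dots> \<le> (\<Sum>j=1..m. p j / card I + p j * b)"
  proof (rule sum_mono)
    fix j assume j: "j \<in> {1..m}"
    have "expect m I p (\<lambda>x. (emp I x j)\<^sup>2) \<le> p j / card I + (p j)\<^sup>2"
      using expect_avg_square[OF assms(1,3,4), of "\<lambda>a. of_bool (a = j)"] mn[OF j]
      by (simp add: power2_eq_square flip: of_bool_conj)
    also have "(p j)\<^sup>2 \<le> p j * b"
      using assms(2)[OF j] p0[OF j] by (simp add: power2_eq_square mult_left_mono)
    finally show "expect m I p (\<lambda>x. (emp I x j)\<^sup>2) \<le> p j / card I + p j * b" by simp
  qed
  also have "\<dots> = 1 / card I + b"
    using one by (simp add: sum.distrib flip: sum_divide_distrib sum_distrib_right)
  finally show ?thesis .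
qed

text \<open>If \<open>x\<close>, \<open>y\<close>, \<open>z\<close> have laws \<open>p\<close>,
  \<open>q\<close>, \<open>r\<close>, its mean is \<open>p + q - 2 r\<close>, that is
  \<open>q - p\<close> for \<open>r = p\<close> and \<open>p - q\<close> for \<open>r = q\<close>;
  hence the change of sign of the statistic.\<close>

definition contrast :: "nat set \<Rightarrow> nat set \<Rightarrow> (nat \<Rightarrow> nat) \<Rightarrow> (nat \<Rightarrow> nat) \<Rightarrow> (nat \<Rightarrow> nat) \<Rightarrow> nat \<Rightarrow> real" where
  "contrast B Z x y z j = emp B x j + emp B y j - 2 * emp Z z j"

text \<open>This is the inner product of the empirical measures \<open>x' - y'\<close> on \<open>A\<close> and \<open>x + y - 2 z\<close> on \<open>B\<close> and \<open>Z\<close>.\<close>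

definition stat :: "nat set \<Rightarrow> nat set \<Rightarrow> nat set \<Rightarrow> (nat \<Rightarrow> nat) \<Rightarrow> (nat \<Rightarrow> nat)
    \<Rightarrow> (nat \<Rightarrow> nat) \<Rightarrow> (nat \<Rightarrow> nat) \<Rightarrow> (nat \<Rightarrow> nat) \<Rightarrow> real" where
  "stat A B Z x' y' x y z =
     avg A (contrast B Z x y z) x' - avg A (contrast B Z x y z) y'"

section \<open>Second moment of the statistic around its mean\<close>

lemma square_sum5_le:
  "(a - b + c + d - 2 * e)\<^sup>2 \<le> 5 * (a\<^sup>2 + b\<^sup>2 + c\<^sup>2 + d\<^sup>2 + 4 * e\<^sup>2)" for a b c d e :: real
proof -
  \<comment> \<open>Lagrange's identity for the terms \<open>a, -b, c, d, -2 e\<close>: the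
    Cauchy-Schwarz defect is the sum of the squared pairwise differences.\<close>
  have "5 * (a\<^sup>2 + b\<^sup>2 + c\<^sup>2 + d\<^sup>2 + 4 * e\<^sup>2) - (a - b + c + d - 2 * e)\<^sup>2 =
    (a + b)\<^sup>2 + (a - c)\<^sup>2 + (a - d)\<^sup>2 + (a + 2 * e)\<^sup>2 + (b + c)\<^sup>2 + (b + d)\<^sup>2 + (b - 2 * e)\<^sup>2
    + (c - d)\<^sup>2 + (c + 2 * e)\<^sup>2 + (d + 2 * e)\<^sup>2"
    by (simp add: power2_eq_square algebra_simps)
  also have "\<dots> \<ge> 0" by simp
  finally show ?thesis by simp
qed

lemma square_sum3_le:
  "(a + b - 2 * c)\<^sup>2 \<le> 3 * (a\<^sup>2 + b\<^sup>2 + 4 * c\<^sup>2)" for a b c :: real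
proof -
  have "3 * (a\<^sup>2 + b\<^sup>2 + 4 * c\<^sup>2) - (a + b - 2 * c)\<^sup>2 =
    (a - b)\<^sup>2 + (a + 2 * c)\<^sup>2 + (b + 2 * c)\<^sup>2"
    by (simp add: power2_eq_square algebra_simps)
  also have "\<dots> \<ge> 0" by simp
  finally show ?thesis by simp
qed

lemma mean_square_le:
  assumes "is_dist m p" "\<And>j. j \<in> {1..m} \<Longrightarrow> p j \<le> b"
  shows "mean m p (\<lambda>j. (g j)\<^sup>2) \<le> b * (\<Sum>j=1..m. (g j)\<^sup>2)"
  unfolding mean_def sum_distrib_left using assms
  by (intro sum_mono mult_right_mono) (auto simp: is_dist_def)

lemma mean_square_le_bound:
  assumes "is_dist m p" "\<And>j. j \<in> {1..m} \<Longrightarrow> \<bar>g j\<bar> \<le> b"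
  shows "mean m p (\<lambda>j. (g j)\<^sup>2) \<le> b\<^sup>2"
proof -
  have "mean m p (\<lambda>j. (g j)\<^sup>2) \<le> mean m p (\<lambda>_. b\<^sup>2)"
    unfolding mean_def using assms
    by (intro sum_mono mult_left_mono power2_le_iff_abs_le[THEN iffD2])
      (auto simp: is_dist_def intro: order_trans[OF abs_ge_zero])
  then show ?thesis by (simp add: mean_const assms)
qed

lemma stat_second_moment:
  assumes p: "is_dist m p" "\<And>j. j \<in> {1..m} \<Longrightarrow> p j \<le> b"
    and q: "is_dist m q" "\<And>j. j \<in> {1..m} \<Longrightarrow> q j \<le> b"
    and r: "is_dist m r" "\<And>j. j \<in> {1..m} \<Longrightarrow> r j \<le> b"
    and A: "finite A" "A \<noteq> {}" and B: "finite B" "B \<noteq> {}" and Z: "finite Z" "Z \<noteq> {}"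
    and b: "b \<ge> 0"
  shows "expect m B p (\<lambda>x. expect m B q (\<lambda>y. expect m Z r (\<lambda>z. expect m A p (\<lambda>x'. expect m A q (\<lambda>y'.
           (stat A B Z x' y' x y z - (\<Sum>j=1..m. (p j - q j) * (p j + q j - 2 * r j)))\<^sup>2)))))
       \<le> 5 * (2 * (b * (3 * (2 * (1 / card B + b) + 4 * (1 / card Z + b))) / card A)
              + b\<^sup>2 * (2 / card B + 4 / card Z))"
proof -
  define w where "w j = p j - q j" for j
  define D where "D = contrast B Z"
  define \<tau> where "\<tau> = (\<Sum>j=1..m. (p j - q j) * (p j + q j - 2 * r j))"
  define Q where "Q = 3 * (2 * (1 / card B + b) + 4 * (1 / card Z + b))"
  have cA: "card A > 0" using A by (simp add: card_gt_0_iff)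
  have wb: "\<bar>w j\<bar> \<le> b" if "j \<in> {1..m}" for j
  proof -
    have "0 \<le> p j" "p j \<le> b" "0 \<le> q j" "q j \<le> b" using p q that by (auto simp: is_dist_def)
    then show ?thesis by (simp add: w_def)
  qed
  note ecs = expect_const[OF p(1) A(1)] expect_const[OF q(1) A(1)] expect_const[OF p(1) B(1)]
     expect_const[OF q(1) B(1)] expect_const[OF r(1) Z(1)]
  let ?E = "\<lambda>F. expect m B p (\<lambda>x. expect m B q (\<lambda>y. expect m Z r (\<lambda>z. expect m A p (\<lambda>x'. expect m A q (\<lambda>y'. F x y z x' y')))))"
  define S where "S x y z = (\<Sum>j=1..m. (D x y z j)\<^sup>2)" for x y z
  define t1 where "t1 x y z x' = (avg A (D x y z) x' - mean m p (D x y z))\<^sup>2" for x y z x'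
  define t2 where "t2 x y z y' = (avg A (D x y z) y' - mean m q (D x y z))\<^sup>2" for x y z y'
  define t3 where "t3 x = (avg B w x - mean m p w)\<^sup>2" for x
  define t4 where "t4 y = (avg B w y - mean m q w)\<^sup>2" for y
  define t5 where "t5 z = (avg Z w z - mean m r w)\<^sup>2" for z
  have pw: "(stat A B Z x' y' x y z - \<tau>)\<^sup>2 \<le> 5 * (t1 x y z x' + t2 x y z y' + t3 x + t4 y + 4 * t5 z)"
    if "x \<in> PiE B (\<lambda>_. {1..m})" "y \<in> PiE B (\<lambda>_. {1..m})" "z \<in> PiE Z (\<lambda>_. {1..m})" for x y z x' y'
  proof -
    \<comment> \<open>The conditional mean of \<open>stat\<close> given \<open>x\<close>,
      \<open>y\<close>, \<open>z\<close> is linear in their empirical measures, so it is a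
      combination of averages of \<open>w\<close>.\<close>
    have "mean m p (D x y z) - mean m q (D x y z) = (\<Sum>j=1..m. w j * D x y z j)"
      by (simp add: mean_def w_def left_diff_distrib sum_subtractf)
    also have "\<dots> = (\<Sum>j=1..m. w j * emp B x j) + (\<Sum>j=1..m. w j * emp B y j) - 2 * (\<Sum>j=1..m. w j * emp Z z j)"
      by (simp add: D_def contrast_def algebra_simps sum.distrib sum_subtractf sum_distrib_left)
    also have "\<dots> = avg B w x + avg B w y - 2 * avg Z w z"
      by (simp add: sum_mult_emp[OF that(1)] sum_mult_emp[OF that(2)] sum_mult_emp[OF that(3)] del: One_nat_def)
    finally have 1: "mean m p (D x y z) - mean m q (D x y z) = avg B w x + avg B w y - 2 * avg Z w z" .
    have 2: "\<tau> = mean m p w + mean m q w - 2 * mean m r w"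
      by (simp add: \<tau>_def mean_def w_def algebra_simps sum.distrib sum_subtractf sum_distrib_left)
    have "stat A B Z x' y' x y z - \<tau> =
      (avg A (D x y z) x' - mean m p (D x y z)) - (avg A (D x y z) y' - mean m q (D x y z))
      + (avg B w x - mean m p w) + (avg B w y - mean m q w) - 2 * (avg Z w z - mean m r w)"
      using 1 2 by (simp add: stat_def D_def)
    then show ?thesis unfolding t1_def t2_def t3_def t4_def t5_def
      by (simp only: square_sum5_le)
  qed
  have ES: "expect m B p (\<lambda>x. expect m B q (\<lambda>y. expect m Z r (\<lambda>z. S x y z))) \<le> Q"
  proof -
    let ?e = "\<lambda>I x. \<Sum>j=1..m. (emp I x j)\<^sup>2"
    have "S x y z \<le> 3 * (?e B x + ?e B y + 4 * ?e Z z)" for x y z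
    proof -
      have "S x y z \<le> (\<Sum>j=1..m. 3 * ((emp B x j)\<^sup>2 + (emp B y j)\<^sup>2 + 4 * (emp Z z j)\<^sup>2))"
        unfolding S_def D_def contrast_def by (intro sum_mono square_sum3_le)
      then show ?thesis by (simp add: sum.distrib sum_distrib_left)
    qed
    then have "expect m B p (\<lambda>x. expect m B q (\<lambda>y. expect m Z r (\<lambda>z. S x y z))) \<le>
      expect m B p (\<lambda>x. expect m B q (\<lambda>y. expect m Z r (\<lambda>z. 3 * (?e B x + ?e B y + 4 * ?e Z z))))"
      by (intro expect_mono p q r)
    also have "\<dots> = 3 * (expect m B p (?e B) + expect m B q (?e B) + 4 * expect m Z r (?e Z))"
      by (simp only: expect_add expect_cmult ecs)
    also have "\<dots> \<le> Q"
      using expect_sum_emp_square[OF p B] expect_sum_emp_square[OF q B] expect_sum_emp_square[OF r Z]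
      unfolding Q_def by simp
    finally show ?thesis .
  qed
  \<comment> \<open>For fixed \<open>x\<close>, \<open>y\<close>, \<open>z\<close> the contrast is a
    deterministic function, so this is a variance bound for i.i.d. letters;
    \<open>p' \<le> b\<close> replaces the second moment by \<open>b\<close> times the unweighted
    sum of squares.\<close>
  have inner: "expect m A p' (\<lambda>x'. (avg A (D x y z) x' - mean m p' (D x y z))\<^sup>2) \<le> b / card A * S x y z"
    if "is_dist m p'" "\<And>j. j \<in> {1..m} \<Longrightarrow> p' j \<le> b" for p' x y z
    using expect_avg_variance[OF that(1) A, of "D x y z"] mean_square_le[OF that, of "D x y z"] cA
    unfolding S_def by (auto elim!: order_trans intro: divide_right_mono)
  have outer: "expect m B p (\<lambda>x. expect m B q (\<lambda>y. expect m Z r (\<lambda>z. G x y z))) \<le> b * Q / card A"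
    if "\<And>x y z. G x y z \<le> b / card A * S x y z" for G
  proof -
    have "expect m B p (\<lambda>x. expect m B q (\<lambda>y. expect m Z r (\<lambda>z. G x y z))) \<le>
      expect m B p (\<lambda>x. expect m B q (\<lambda>y. expect m Z r (\<lambda>z. b / card A * S x y z)))"
      by (intro expect_mono p q r that)
    also have "\<dots> = b / card A * expect m B p (\<lambda>x. expect m B q (\<lambda>y. expect m Z r (\<lambda>z. S x y z)))"
      by (simp only: expect_cmult)
    also have "\<dots> \<le> b / card A * Q" using ES b by (intro mult_left_mono) auto
    finally show ?thesis by simp
  qed
  have e1: "?E (\<lambda>x y z x' y'. t1 x y z x') \<le> b * Q / card A"
    unfolding ecs t1_def by (rule outer, rule inner[OF p])
  have e2: "?E (\<lambda>x y z x' y'. t2 x y z y') \<le> b * Q / card A"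
    unfolding ecs t2_def by (rule outer, rule inner[OF q])
  have e3: "?E (\<lambda>x y z x' y'. t3 x) \<le> b\<^sup>2 / card B"
    unfolding ecs t3_def
    using expect_avg_variance[OF p(1) B, of w] mean_square_le_bound[OF p(1) wb]
    by (auto elim!: order_trans intro: divide_right_mono)
  have e4: "?E (\<lambda>x y z x' y'. t4 y) \<le> b\<^sup>2 / card B"
    unfolding ecs t4_def
    using expect_avg_variance[OF q(1) B, of w] mean_square_le_bound[OF q(1) wb]
    by (auto elim!: order_trans intro: divide_right_mono)
  have e5: "?E (\<lambda>x y z x' y'. t5 z) \<le> b\<^sup>2 / card Z"
    unfolding ecs t5_def
    using expect_avg_variance[OF r(1) Z, of w] mean_square_le_bound[OF r(1) wb]
    by (auto elim!: order_trans intro: divide_right_mono)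
  have "?E (\<lambda>x y z x' y'. (stat A B Z x' y' x y z - \<tau>)\<^sup>2) \<le>
    ?E (\<lambda>x y z x' y'. 5 * (t1 x y z x' + t2 x y z y' + t3 x + t4 y + 4 * t5 z))"
    by (intro expect_mono p q r pw)
  also have "\<dots> = 5 * (?E (\<lambda>x y z x' y'. t1 x y z x') + ?E (\<lambda>x y z x' y'. t2 x y z y')
     + ?E (\<lambda>x y z x' y'. t3 x) + ?E (\<lambda>x y z x' y'. t4 y) + 4 * ?E (\<lambda>x y z x' y'. t5 z))"
    by (simp only: expect_add expect_cmult)
  also have "\<dots> \<le> 5 * (b * Q / card A + b * Q / card A + b\<^sup>2 / card B + b\<^sup>2 / card B + 4 * (b\<^sup>2 / card Z))"
    using e1 e2 e3 e4 e5 by (intro mult_left_mono add_mono) auto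
  also have "\<dots> = 5 * (2 * (b * Q / card A) + b\<^sup>2 * (2 / card B + 4 / card Z))"
    by (simp add: algebra_simps)
  finally show ?thesis unfolding Q_def \<tau>_def .
qed

section \<open>Achievability\<close>

lemma prob3_eq_expect:
  "prob3 m N n p q r E = expect m {0..<N} p (\<lambda>x. expect m {0..<N} q (\<lambda>y. expect m {0..<n} r (\<lambda>z. of_bool (E x y z))))"
  unfolding prob3_def expect_def seqs_def sum_distrib_left lessThan_atLeast0
  by (intro sum.cong refl) auto

lemma prob3_bounds:
  assumes "is_dist m p" "is_dist m q" "is_dist m r"
  shows "0 \<le> prob3 m N n p q r E" "prob3 m N n p q r E \<le> 1"
proof -
  let ?E = "\<lambda>F. expect m {0..<N} p (\<lambda>x. expect m {0..<N} q (\<lambda>y. expect m {0..<n} r (\<lambda>z. F x y z)))"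
  have c: "?E (\<lambda>x y z. c) = c" for c by (simp add: expect_const assms)
  have "?E (\<lambda>x y z. 0) \<le> prob3 m N n p q r E" "prob3 m N n p q r E \<le> ?E (\<lambda>x y z. 1)"
    unfolding prob3_eq_expect by (intro expect_mono assms; simp)+
  then show "0 \<le> prob3 m N n p q r E" "prob3 m N n p q r E \<le> 1" unfolding c .
qed

section \<open>The worst-case error as a supremum\<close>

abbreviation avg_error :: "nat \<Rightarrow> nat \<Rightarrow> nat \<Rightarrow> (nat \<Rightarrow> real) \<Rightarrow> (nat \<Rightarrow> real)
    \<Rightarrow> ((nat \<Rightarrow> nat) \<Rightarrow> (nat \<Rightarrow> nat) \<Rightarrow> (nat \<Rightarrow> nat) \<Rightarrow> bool) \<Rightarrow> real" where
  "avg_error m N n p q \<phi> \<equiv> (1/2) * prob3 m N n p q p \<phi> + (1/2) * prob3 m N n p q q (\<lambda>x y z. \<not> \<phi> x y z)"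

lemma avg_error_bounds:
  assumes "is_dist m p" "is_dist m q"
  shows "0 \<le> avg_error m N n p q \<phi>" "avg_error m N n p q \<phi> \<le> 1"
  using prob3_bounds[OF assms assms(1), of N n \<phi>]
    prob3_bounds[OF assms assms(2), of N n "\<lambda>x y z. \<not> \<phi> x y z"] by linarith+

text \<open>Average errors are at most 1, so the real supremum is over a set bounded above and
  dominates each element.\<close>

lemma avg_error_le_Pe:
  assumes "admissible eps c m p q"
  shows "avg_error m (N m) (n m) p q (\<phi> m) \<le> Pe eps c N n \<phi> m"
proof -
  let ?S = "{(p, q). admissible eps c m p q}"
  let ?g = "\<lambda>pm. avg_error m (N m) (n m) (fst pm) (snd pm) (\<phi> m)"
  have "bdd_above (?g ` ?S)"
  proof (rule bdd_aboveI2)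
    fix pm assume "pm \<in> ?S"
    then have "is_dist m (fst pm)" "is_dist m (snd pm)" by (auto simp: admissible_def)
    then show "?g pm \<le> 1" by (rule avg_error_bounds)
  qed
  then show ?thesis unfolding Pe_def using assms
    by (intro cSUP_upper2[of _ _ "(p, q)"]) auto
qed

text \<open>The pair \<open>p0\<close>, \<open>q0\<close> makes the supremum one over a nonempty
  set; over the empty set a real supremum has an unspecified value.\<close>

lemma Pe_le:
  assumes "admissible eps c m p0 q0"
    and "\<And>p q. admissible eps c m p q \<Longrightarrow> avg_error m (N m) (n m) p q (\<phi> m) \<le> M"
  shows "Pe eps c N n \<phi> m \<le> M"
  unfolding Pe_def using assms by (intro cSUP_least) auto

lemma Pe_nonneg:
  assumes "admissible eps c m p q"
  shows "0 \<le> Pe eps c N n \<phi> m"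
  using avg_error_le_Pe[OF assms, of N n \<phi>] avg_error_bounds(1)[of m p q] assms
  unfolding admissible_def by (meson order_trans)

text \<open>The order of integration on the right is the one in which \<open>stat\<close> becomes, conditionally on the
  samples defining the contrast, a difference of two averages of i.i.d. variables.\<close>

lemma expect_split_samples:
  assumes "finite A" "finite B" "A \<inter> B = {}"
  shows "expect m (A \<union> B) p (\<lambda>x. expect m (A \<union> B) q (\<lambda>y. expect m Z r (\<lambda>z.
            G (restrict x A) (restrict x B) (restrict y A) (restrict y B) z)))
       = expect m B p (\<lambda>x. expect m B q (\<lambda>y. expect m Z r (\<lambda>z. expect m A p (\<lambda>x'. expect m A q (\<lambda>y'. G x' x y' y z)))))"
proof -
  have "expect m (A \<union> B) p (\<lambda>x. expect m (A \<union> B) q (\<lambda>y. expect m Z r (\<lambda>z.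
            G (restrict x A) (restrict x B) (restrict y A) (restrict y B) z)))
      = expect m (A \<union> B) p (\<lambda>x. expect m A q (\<lambda>y'. expect m B q (\<lambda>y. expect m Z r (\<lambda>z.
            G (restrict x A) (restrict x B) y' y z))))"
    by (intro expect_cong expect_split[OF assms, of _ _ "\<lambda>y' y. expect m Z r (\<lambda>z. G _ _ y' y z)"])
  also have "\<dots> = expect m A p (\<lambda>x'. expect m B p (\<lambda>x. expect m A q (\<lambda>y'. expect m B q (\<lambda>y. expect m Z r (\<lambda>z. G x' x y' y z)))))"
    by (rule expect_split[OF assms, of _ _ "\<lambda>x' x. expect m A q (\<lambda>y'. expect m B q (\<lambda>y. expect m Z r (\<lambda>z. G x' x y' y z)))"])
  also have "\<dots> = expect m B p (\<lambda>x. expect m A p (\<lambda>x'. expect m A q (\<lambda>y'. expect m B q (\<lambda>y. expect m Z r (\<lambda>z. G x' x y' y z)))))"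
    by (rule expect_swap)
  also have "\<dots> = expect m B p (\<lambda>x. expect m A p (\<lambda>x'. expect m B q (\<lambda>y. expect m A q (\<lambda>y'. expect m Z r (\<lambda>z. G x' x y' y z)))))"
    by (rule expect_cong, rule expect_cong, rule expect_swap)
  also have "\<dots> = expect m B p (\<lambda>x. expect m B q (\<lambda>y. expect m A p (\<lambda>x'. expect m A q (\<lambda>y'. expect m Z r (\<lambda>z. G x' x y' y z)))))"
    by (rule expect_cong, rule expect_swap)
  also have "\<dots> = expect m B p (\<lambda>x. expect m B q (\<lambda>y. expect m A p (\<lambda>x'. expect m Z r (\<lambda>z. expect m A q (\<lambda>y'. G x' x y' y z)))))"
    by (rule expect_cong, rule expect_cong, rule expect_cong, rule expect_swap)
  also have "\<dots> = expect m B p (\<lambda>x. expect m B q (\<lambda>y. expect m Z r (\<lambda>z. expect m A p (\<lambda>x'. expect m A q (\<lambda>y'. G x' x y' y z)))))"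
    by (rule expect_cong, rule expect_cong, rule expect_swap)
  finally show ?thesis .
qed

lemma avg_cong: "(\<And>i. i \<in> I \<Longrightarrow> x i = y i) \<Longrightarrow> avg I g x = avg I g y"
  by (simp add: avg_def cong: sum.cong)

lemma stat_restrict:
  "stat A B Z (restrict x A) (restrict y A) (restrict x B) (restrict y B) z = stat A B Z x y x y z"
proof -
  have "avg I g (restrict w I) = avg I g w" for I g w by (rule avg_cong) simp
  then show ?thesis by (simp add: stat_def contrast_def[abs_def])
qed

section \<open>Error of the split-sample classifier\<close>

definition split_stat :: "nat \<Rightarrow> nat \<Rightarrow> (nat \<Rightarrow> nat) \<Rightarrow> (nat \<Rightarrow> nat) \<Rightarrow> (nat \<Rightarrow> nat) \<Rightarrow> real" where
  "split_stat N n x y z = stat {0..<N div 2} {N div 2..<N} {0..<n} x y x y z"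

text \<open>Both kinds of error are covered at once: \<open>\<tau>\<close> may have either sign, and
  the event \<open>E\<close> has only to force a deviation of at least
  \<open>\<bar>\<tau>\<bar>\<close>.\<close>

lemma split_stat_chebyshev:
  fixes b :: real
  assumes p: "is_dist m p" "\<And>j. j \<in> {1..m} \<Longrightarrow> p j \<le> b"
    and q: "is_dist m q" "\<And>j. j \<in> {1..m} \<Longrightarrow> q j \<le> b"
    and r: "is_dist m r" "\<And>j. j \<in> {1..m} \<Longrightarrow> r j \<le> b"
    and b: "b \<ge> 0" and N: "N \<ge> 2" and n: "n \<ge> 1"
    and \<tau>: "\<tau> = (\<Sum>j=1..m. (p j - q j) * (p j + q j - 2 * r j))" "\<tau> \<noteq> 0"
    and E: "\<And>x y z. E x y z \<Longrightarrow> \<tau>\<^sup>2 \<le> (split_stat N n x y z - \<tau>)\<^sup>2"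
  shows "prob3 m N n p q r E \<le>
     5 * (2 * (b * (3 * (2 * (3 / N + b) + 4 * (1 / n + b))) * (3 / N)) + b\<^sup>2 * (6 / N + 4 / n)) / \<tau>\<^sup>2"
proof -
  let ?A = "{0..<N div 2}" and ?B = "{N div 2..<N}" and ?Z = "{0..<n}"
  have AB: "?A \<union> ?B = {0..<N}" "?A \<inter> ?B = {}" by auto
  have h: "1 / card ?A \<le> 3 / N" "1 / card ?B \<le> 3 / N"
  proof -
    \<comment> \<open>For \<open>N \<ge> 2\<close> each half, rounded down or up, holds at least a
      third of the sample.\<close>
    have "N \<le> 3 * (N div 2)" "N \<le> 3 * (N - N div 2)" using N by linarith+
    then have "real N \<le> 3 * real (N div 2)" "real N \<le> 3 * real (N - N div 2)" by linarith+
    moreover have "N div 2 > 0" "N - N div 2 > 0" using N by auto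
    ultimately show "1 / card ?A \<le> 3 / N" "1 / card ?B \<le> 3 / N"
      using N by (auto simp: field_simps)
  qed
  have "prob3 m N n p q r E = expect m {0..<N} p (\<lambda>x. expect m {0..<N} q (\<lambda>y. expect m ?Z r (\<lambda>z. of_bool (E x y z))))"
    by (rule prob3_eq_expect)
  also have "\<dots> \<le> expect m {0..<N} p (\<lambda>x. expect m {0..<N} q (\<lambda>y. expect m ?Z r (\<lambda>z. (split_stat N n x y z - \<tau>)\<^sup>2 / \<tau>\<^sup>2)))"
    using E \<tau>(2) by (intro expect_mono p q r) (auto simp: of_bool_def)
  also have "\<dots> = expect m {0..<N} p (\<lambda>x. expect m {0..<N} q (\<lambda>y. expect m ?Z r (\<lambda>z. (split_stat N n x y z - \<tau>)\<^sup>2))) / \<tau>\<^sup>2"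
    using expect_multc[of _ _ _ _ "1 / \<tau>\<^sup>2"] by simp
  also have "expect m {0..<N} p (\<lambda>x. expect m {0..<N} q (\<lambda>y. expect m ?Z r (\<lambda>z. (split_stat N n x y z - \<tau>)\<^sup>2))) =
    expect m ?B p (\<lambda>x. expect m ?B q (\<lambda>y. expect m ?Z r (\<lambda>z. expect m ?A p (\<lambda>x'. expect m ?A q (\<lambda>y'.
           (stat ?A ?B ?Z x' y' x y z - \<tau>)\<^sup>2)))))"
    using expect_split_samples[OF _ _ AB(2), of m p q ?Z r "\<lambda>x' x y' y z. (stat ?A ?B ?Z x' y' x y z - \<tau>)\<^sup>2"]
    by (simp only: AB(1) stat_restrict split_stat_def finite_atLeastLessThan simp_thms)
  also have "\<dots> \<le> 5 * (2 * (b * (3 * (2 * (1 / card ?B + b) + 4 * (1 / card ?Z + b))) / card ?A)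
              + b\<^sup>2 * (2 / card ?B + 4 / card ?Z))"
    unfolding \<tau>(1) using N n b by (intro stat_second_moment p q r) auto
  also have "\<dots> = 5 * (2 * (b * (3 * (2 * (1 / card ?B + b) + 4 * (1 / n + b))) * (1 / card ?A))
              + b\<^sup>2 * (2 * (1 / card ?B) + 4 / n))" by simp
  also have "\<dots> \<le> 5 * (2 * (b * (3 * (2 * (3 / N + b) + 4 * (1 / n + b))) * (3 / N))
              + b\<^sup>2 * (2 * (3 / N) + 4 / n))"
    using b h by (intro mult_left_mono add_mono mult_mono mult_nonneg_nonneg) auto
  finally show ?thesis by (simp add: divide_right_mono)
qed

text \<open>The bound of \<open>split_stat_chebyshev\<close> with \<open>b = c / m\<close> and with
  \<open>\<tau>\<^sup>2\<close> replaced by its lower bound \<open>eps ^ 4 / m\<^sup>2\<close>,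
  sorted by the four ratios that have to vanish.\<close>

definition error_bound :: "real \<Rightarrow> real \<Rightarrow> real \<Rightarrow> real \<Rightarrow> real \<Rightarrow> real" where
  "error_bound eps c m N n = 5 / eps ^ 4 *
     (108 * c * (m / N\<^sup>2) + 72 * c * (m / (N * n)) + 114 * c\<^sup>2 * (1 / N) + 4 * c\<^sup>2 * (1 / n))"

text \<open>The mean of the statistic is \<open>- \<delta>\<close> under the null and
  \<open>\<delta>\<close> under the alternative, so a wrong sign is a deviation of at least
  \<open>\<delta>\<close>.\<close>

lemma split_stat_error:
  assumes adm: "admissible eps c m p q" and eps: "eps > 0" and c: "c \<ge> 0" and m: "m > 0"
    and N: "N \<ge> 2" and n: "n \<ge> 1"
  shows "avg_error m N n p q (\<lambda>x y z. split_stat N n x y z > 0) \<le> error_bound eps c m N n"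
proof -
  define \<delta> where "\<delta> = (\<Sum>j=1..m. (p j - q j)\<^sup>2)"
  define b where "b = c / m"
  have p: "is_dist m p" "\<And>j. j \<in> {1..m} \<Longrightarrow> p j \<le> b" and q: "is_dist m q" "\<And>j. j \<in> {1..m} \<Longrightarrow> q j \<le> b"
    using adm by (auto simp: admissible_def b_def)
  have b: "b \<ge> 0" using c by (simp add: b_def)
  have "eps\<^sup>2 \<le> (\<Sum>j=1..m. \<bar>q j - p j\<bar>)\<^sup>2"
    using adm eps by (intro power_mono) (auto simp: admissible_def)
  also have "\<dots> \<le> (\<Sum>j=1..m. \<bar>q j - p j\<bar>\<^sup>2) * real (card {1..m})"
    by (rule sum_squared_le_sum_of_squares)
  also have "\<dots> = \<delta> * m" by (simp add: \<delta>_def power2_commute)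
  finally have d: "eps\<^sup>2 / m \<le> \<delta>" using m by (simp add: field_simps)
  moreover have "eps\<^sup>2 / m > 0" using eps m by simp
  ultimately have d0: "\<delta> > 0" by linarith
  have "(eps\<^sup>2 / m)\<^sup>2 \<le> \<delta>\<^sup>2" using d eps by (intro power_mono) auto
  then have d2: "eps ^ 4 / (real m)\<^sup>2 \<le> \<delta>\<^sup>2" by (simp add: power_divide flip: power_mult)
  let ?M = "5 * (2 * (b * (3 * (2 * (3 / N + b) + 4 * (1 / n + b))) * (3 / N)) + b\<^sup>2 * (6 / N + 4 / n))"
  have M0: "?M \<ge> 0" using b by simp
  have "?M / \<delta>\<^sup>2 \<le> ?M / (eps ^ 4 / (real m)\<^sup>2)"
    using d2 M0 eps m by (intro divide_left_mono mult_pos_pos divide_pos_pos zero_less_power) (auto simp: d0)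
  also have "\<dots> = error_bound eps c m N n"
    using m N n eps unfolding b_def error_bound_def by (simp add: field_simps power2_eq_square)
  finally have M: "?M / \<delta>\<^sup>2 \<le> error_bound eps c m N n" .
  have "prob3 m N n p q p (\<lambda>x y z. split_stat N n x y z > 0) \<le> ?M / (- \<delta>)\<^sup>2"
  proof (rule split_stat_chebyshev[OF p q p b N n])
    show "- \<delta> = (\<Sum>j=1..m. (p j - q j) * (p j + q j - 2 * p j))"
      by (simp add: \<delta>_def power2_eq_square algebra_simps flip: sum_negf)
    fix x y z assume "split_stat N n x y z > 0"
    then show "(- \<delta>)\<^sup>2 \<le> (split_stat N n x y z - - \<delta>)\<^sup>2"
      using d0 by (simp add: power_mono)
  qed (use d0 in auto)
  moreover have "prob3 m N n p q q (\<lambda>x y z. \<not> split_stat N n x y z > 0) \<le> ?M / \<delta>\<^sup>2"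
  proof (rule split_stat_chebyshev[OF p q q b N n])
    show "\<delta> = (\<Sum>j=1..m. (p j - q j) * (p j + q j - 2 * q j))"
      by (simp add: \<delta>_def power2_eq_square algebra_simps)
    fix x y z assume "\<not> split_stat N n x y z > 0"
    then show "\<delta>\<^sup>2 \<le> (split_stat N n x y z - \<delta>)\<^sup>2"
      using d0 by (intro power2_le_iff_abs_le[THEN iffD2] abs_le_square_iff[THEN iffD1]) auto
  qed (use d0 in auto)
  ultimately show ?thesis using M by simp
qed

lemma error_bound_tendsto_0:
  fixes N n :: "nat \<Rightarrow> nat"
  assumes "\<forall>m. 0 < N m" "\<forall>m. 0 < n m" "filterlim N at_top at_top" "filterlim n at_top at_top"
    "(\<lambda>m. real m) \<in> o(\<lambda>m. real (min ((N m)\<^sup>2) (N m * n m)))"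
  shows "(\<lambda>m. error_bound eps c m (N m) (n m)) \<longlonglongrightarrow> 0"
proof -
  let ?mn = "\<lambda>m. real (min ((N m)\<^sup>2) (N m * n m))"
  have lim: "(\<lambda>m. real m / ?mn m) \<longlonglongrightarrow> 0" using assms(5) by (rule smalloD_tendsto)
  have pos: "?mn m > 0" for m using assms(1,2) by simp
  have "(\<lambda>m. real m / (real (N m))\<^sup>2) \<longlonglongrightarrow> 0"
  proof (rule tendsto_sandwich[OF _ _ tendsto_const lim])
    have "real m / (real (N m))\<^sup>2 \<le> real m / ?mn m" for m
      using pos[of m] assms(1) by (intro divide_left_mono) (auto simp flip: of_nat_power)
    then show "\<forall>\<^sub>F m in sequentially. real m / (real (N m))\<^sup>2 \<le> real m / ?mn m" by simp
  qed simp
  moreover have "(\<lambda>m. real m / (real (N m) * real (n m))) \<longlonglongrightarrow> 0"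
  proof (rule tendsto_sandwich[OF _ _ tendsto_const lim])
    have "real m / (real (N m) * real (n m)) \<le> real m / ?mn m" for m
      using pos[of m] assms(1,2) by (intro divide_left_mono) (auto simp flip: of_nat_mult)
    then show "\<forall>\<^sub>F m in sequentially. real m / (real (N m) * real (n m)) \<le> real m / ?mn m" by simp
  qed simp
  moreover have "(\<lambda>m. 1 / real (f m)) \<longlonglongrightarrow> 0" if "filterlim f at_top at_top" for f :: "nat \<Rightarrow> nat"
    using filterlim_compose[OF lim_1_over_n that] by simp
  ultimately have "(\<lambda>m. error_bound eps c m (N m) (n m)) \<longlonglongrightarrow>
    5 / eps ^ 4 * (108 * c * 0 + 72 * c * 0 + 114 * c\<^sup>2 * 0 + 4 * c\<^sup>2 * 0)"
    unfolding error_bound_def using assms(3,4) by (intro tendsto_intros) auto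
  then show ?thesis by simp
qed

theorem consistent_classifier_exists:
  fixes N n :: "nat \<Rightarrow> nat"
  assumes "\<forall>m. 0 < N m" "\<forall>m. 0 < n m" "filterlim N at_top at_top" "filterlim n at_top at_top"
    "(\<lambda>m. real m) \<in> o(\<lambda>m. real (min ((N m)\<^sup>2) (N m * n m)))"
    and "eps > 0" "c \<ge> 0" and adm: "\<forall>\<^sub>F m in sequentially. \<exists>p q. admissible eps c m p q"
  shows "asymp_consistent eps c N n (\<lambda>m x y z. split_stat (N m) (n m) x y z > 0)"
  unfolding asymp_consistent_def
proof (rule tendsto_sandwich[OF _ _ tendsto_const error_bound_tendsto_0[OF assms(1-5)]])
  show "\<forall>\<^sub>F m in sequentially. 0 \<le> Pe eps c N n (\<lambda>m x y z. split_stat (N m) (n m) x y z > 0) m"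
    using adm by eventually_elim (auto intro: Pe_nonneg)
  have "\<forall>\<^sub>F m in sequentially. N m \<ge> 2"
    using assms(3) by (simp add: filterlim_at_top)
  with adm eventually_gt_at_top[of 0]
  show "\<forall>\<^sub>F m in sequentially. Pe eps c N n (\<lambda>m x y z. split_stat (N m) (n m) x y z > 0) m
      \<le> error_bound eps c m (N m) (n m)"
  proof eventually_elim
    case (elim m)
    then obtain p q where "admissible eps c m p q" by blast
    then show ?case using elim assms
      by (intro Pe_le split_stat_error) (auto simp: Suc_le_eq)
  qed
qed

section \<open>Lower bounds by mixtures of block distributions\<close>

abbreviation weight3 :: "nat \<Rightarrow> nat \<Rightarrow> (nat \<Rightarrow> real) \<Rightarrow> (nat \<Rightarrow> real) \<Rightarrow> (nat \<Rightarrow> real)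
    \<Rightarrow> (nat \<Rightarrow> nat) \<Rightarrow> (nat \<Rightarrow> nat) \<Rightarrow> (nat \<Rightarrow> nat) \<Rightarrow> real" where
  "weight3 N n p q r x y z \<equiv> (\<Prod>i<N. p (x i)) * (\<Prod>i<N. q (y i)) * (\<Prod>i<n. r (z i))"

text \<open>Moving the sum over \<open>F\<close> inside leaves only the likelihood of each triple
  under the mixture, up to the factor \<open>card F\<close>.\<close>

lemma sum_prob3:
  "(\<Sum>f\<in>F. prob3 m N n (p f) (q f) (r f) E) =
     (\<Sum>x\<in>seqs m N. \<Sum>y\<in>seqs m N. \<Sum>z\<in>seqs m n.
        if E x y z then \<Sum>f\<in>F. weight3 N n (p f) (q f) (r f) x y z else 0)"
proof -
  have "(\<Sum>f\<in>F. prob3 m N n (p f) (q f) (r f) E) =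
     (\<Sum>x\<in>seqs m N. \<Sum>y\<in>seqs m N. \<Sum>z\<in>seqs m n. \<Sum>f\<in>F.
        if E x y z then weight3 N n (p f) (q f) (r f) x y z else 0)"
    unfolding prob3_def by (simp only: sum.swap[of _ _ F])
  also have "\<dots> = (\<Sum>x\<in>seqs m N. \<Sum>y\<in>seqs m N. \<Sum>z\<in>seqs m n.
        if E x y z then \<Sum>f\<in>F. weight3 N n (p f) (q f) (r f) x y z else 0)"
    by (intro sum.cong refl) auto
  finally show ?thesis .
qed

lemma prob3_mono:
  assumes "is_dist m p" "is_dist m q" "is_dist m r" "\<And>x y z. E x y z \<Longrightarrow> E' x y z"
  shows "prob3 m N n p q r E \<le> prob3 m N n p q r E'"
  unfolding prob3_eq_expect using assms by (intro expect_mono) (auto simp: of_bool_def)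

lemma prob3_Un:
  "prob3 m N n p q r (\<lambda>x y z. E x y z \<and> \<phi> x y z) + prob3 m N n p q r (\<lambda>x y z. E x y z \<and> \<not> \<phi> x y z)
    = prob3 m N n p q r E"
  unfolding prob3_eq_expect expect_add[symmetric] by (intro expect_cong) auto

text \<open>Two mixtures, one of null and one of alternative hypotheses, that agree on an event \<open>E\<close> cannot
  be told apart on \<open>E\<close>.\<close>

lemma Pe_ge_mixture:
  fixes N n :: "nat \<Rightarrow> nat"
  assumes F: "finite F" "F \<noteq> {}"
    and adm: "\<And>f. f \<in> F \<Longrightarrow> admissible eps c m (p f) (q f)"
             "\<And>f. f \<in> F \<Longrightarrow> admissible eps c m (p' f) (q' f)"
    and eq: "\<And>x y z. E x y z \<Longrightarrow> (\<Sum>f\<in>F. weight3 (N m) (n m) (p f) (q f) (p f) x y z)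
                 = (\<Sum>f\<in>F. weight3 (N m) (n m) (p' f) (q' f) (q' f) x y z)"
    and \<alpha>: "\<And>f. f \<in> F \<Longrightarrow> \<alpha> \<le> prob3 m (N m) (n m) (p f) (q f) (p f) E"
  shows "\<alpha> / 4 \<le> Pe eps c N n \<phi> m"
proof -
  let ?P = "Pe eps c N n \<phi> m"
  let ?A = "\<lambda>f E. prob3 m (N m) (n m) (p f) (q f) (p f) E"
  let ?B = "\<lambda>f E. prob3 m (N m) (n m) (p' f) (q' f) (q' f) E"
  have d: "is_dist m (p f)" "is_dist m (q f)" "is_dist m (p' f)" "is_dist m (q' f)" if "f \<in> F" for f
    using adm that by (auto simp: admissible_def)
  \<comment> \<open>Each error probability enters the average error with weight 1/2, hence the
    factor 2; the two kinds together give the 4 of the claim.\<close>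
  have 1: "?A f (\<lambda>x y z. E x y z \<and> \<phi> m x y z) \<le> 2 * ?P" if "f \<in> F" for f
  proof -
    have "?A f (\<lambda>x y z. E x y z \<and> \<phi> m x y z) \<le> ?A f (\<phi> m)"
      by (intro prob3_mono d that) auto
    also have "\<dots> \<le> 2 * avg_error m (N m) (n m) (p f) (q f) (\<phi> m)"
      using prob3_bounds(1)[OF d(1) d(2) d(2)] that by simp
    also have "\<dots> \<le> 2 * ?P"
      using avg_error_le_Pe[OF adm(1)[OF that], of N n \<phi>] by (intro mult_left_mono) auto
    finally show ?thesis .
  qed
  have 2: "?B f (\<lambda>x y z. E x y z \<and> \<not> \<phi> m x y z) \<le> 2 * ?P" if "f \<in> F" for f
  proof -
    have "?B f (\<lambda>x y z. E x y z \<and> \<not> \<phi> m x y z) \<le> ?B f (\<lambda>x y z. \<not> \<phi> m x y z)"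
      by (intro prob3_mono d that) auto
    also have "\<dots> \<le> 2 * avg_error m (N m) (n m) (p' f) (q' f) (\<phi> m)"
      using prob3_bounds(1)[OF d(3) d(4) d(3)] that by simp
    also have "\<dots> \<le> 2 * ?P"
      using avg_error_le_Pe[OF adm(2)[OF that], of N n \<phi>] by (intro mult_left_mono) auto
    finally show ?thesis .
  qed
  have "card F * \<alpha> = (\<Sum>f\<in>F. \<alpha>)" by simp
  also have "\<dots> \<le> (\<Sum>f\<in>F. ?A f E)" using \<alpha> by (rule sum_mono)
  also have "\<dots> = (\<Sum>f\<in>F. ?A f (\<lambda>x y z. E x y z \<and> \<phi> m x y z)) + (\<Sum>f\<in>F. ?A f (\<lambda>x y z. E x y z \<and> \<not> \<phi> m x y z))"
    by (simp add: prob3_Un flip: sum.distrib)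
  \<comment> \<open>Equal likelihoods on \<open>E\<close> turn the null mass where the classifier is
    right into alternative mass where it errs.\<close>
  also have "(\<Sum>f\<in>F. ?A f (\<lambda>x y z. E x y z \<and> \<not> \<phi> m x y z)) = (\<Sum>f\<in>F. ?B f (\<lambda>x y z. E x y z \<and> \<not> \<phi> m x y z))"
    unfolding sum_prob3 by (rule sum.cong[OF refl])+ (auto simp: eq)
  also have "(\<Sum>f\<in>F. ?A f (\<lambda>x y z. E x y z \<and> \<phi> m x y z)) + (\<Sum>f\<in>F. ?B f (\<lambda>x y z. E x y z \<and> \<not> \<phi> m x y z))
     \<le> (\<Sum>f\<in>F. 2 * ?P) + (\<Sum>f\<in>F. 2 * ?P)"
    by (intro add_mono sum_mono 1 2)
  finally have "card F * \<alpha> \<le> card F * (4 * ?P)" by simp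
  moreover have "card F > 0" using F by (simp add: card_gt_0_iff)
  ultimately show ?thesis by simp
qed

text \<open>The letters \<open>1, \<dots>, s k\<close> form \<open>s\<close> consecutive blocks of size \<open>k\<close>; \<open>sel k s f\<close> is uniform on the
  set that contains the letter of offset \<open>f b\<close> of every block \<open>b\<close>.\<close>

definition blk :: "nat \<Rightarrow> nat \<Rightarrow> nat" where "blk k j = (j - 1) div k"

definition unif :: "nat \<Rightarrow> nat \<Rightarrow> nat \<Rightarrow> real" where
  "unif k s j = (if j \<in> {1..s * k} then 1 / (s * k) else 0)"

definition sel :: "nat \<Rightarrow> nat \<Rightarrow> (nat \<Rightarrow> nat) \<Rightarrow> nat \<Rightarrow> real" where
  "sel k s f j = (if j \<in> {1..s * k} \<and> (j - 1) mod k = f (blk k j) then 1 / s else 0)"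

section \<open>Block distributions and their distances\<close>

lemma sum_blocks:
  fixes G :: "nat \<Rightarrow> nat \<Rightarrow> real"
  assumes "k > 0"
  shows "(\<Sum>j=1..s * k. G (blk k j) ((j - 1) mod k)) = (\<Sum>b<s. \<Sum>t<k. G b t)"
proof -
  have "(\<Sum>j=1..s * k. G (blk k j) ((j - 1) mod k)) = (\<Sum>j<s * k. G (j div k) (j mod k))"
    by (rule sum.reindex_bij_witness[of _ Suc "\<lambda>j. j - 1"]) (auto simp: blk_def)
  also have "\<dots> = (\<Sum>b<s. \<Sum>j=b * k..<b * k + k. G (j div k) (j mod k))"
    by (rule sum.nat_group[symmetric])
  also have "\<dots> = (\<Sum>b<s. \<Sum>t<k. G b t)"
  proof (rule sum.cong[OF refl])
    fix b
    have "(\<Sum>j=b * k..<b * k + k. G (j div k) (j mod k)) = (\<Sum>t<k. G ((t + b * k) div k) ((t + b * k) mod k))"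
      using sum.shift_bounds_nat_ivl[of "\<lambda>j. G (j div k) (j mod k)" 0 "b * k" k]
      by (simp add: lessThan_atLeast0 add.commute)
    also have "\<dots> = (\<Sum>t<k. G b t)" using assms by (intro sum.cong) auto
    finally show "(\<Sum>j=b * k..<b * k + k. G (j div k) (j mod k)) = (\<Sum>t<k. G b t)" .
  qed
  finally show ?thesis .
qed

text \<open>Letters beyond \<open>s * k\<close> contribute nothing, which absorbs the remainder when
  \<open>k\<close> does not divide \<open>m\<close>.\<close>

lemma sum_supported_blocks:
  fixes G :: "nat \<Rightarrow> nat \<Rightarrow> real"
  assumes "k > 0" "s * k \<le> m" "\<And>j. j \<in> {1..s * k} \<Longrightarrow> h j = G (blk k j) ((j - 1) mod k)"
    "\<And>j. j \<in> {1..m} - {1..s * k} \<Longrightarrow> h j = 0"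
  shows "(\<Sum>j=1..m. h j) = (\<Sum>b<s. \<Sum>t<k. G b t)"
proof -
  have "(\<Sum>j=1..m. h j) = (\<Sum>j=1..s * k. h j)"
    using assms by (intro sum.mono_neutral_right) auto
  also have "\<dots> = (\<Sum>j=1..s * k. G (blk k j) ((j - 1) mod k))"
    using assms(3) by (intro sum.cong) auto
  finally show ?thesis using sum_blocks[OF assms(1)] by simp
qed

text \<open>The common properties of \<open>unif\<close> and \<open>sel\<close> from which the
  avoidance bounds follow, whatever \<open>f\<close> is.\<close>

definition block_uniform :: "nat \<Rightarrow> nat \<Rightarrow> nat \<Rightarrow> (nat \<Rightarrow> real) \<Rightarrow> bool" where
  "block_uniform k s m p \<longleftrightarrow> is_dist m p \<and> (\<forall>j\<in>{1..m} - {1..s * k}. p j = 0) \<and>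
     (\<forall>b. (\<Sum>j=1..m. if blk k j = b then p j else 0) \<le> 1 / s)"

text \<open>\<open>G b t\<close> stands for the mass of the letter of offset \<open>t\<close> in
  block \<open>b\<close>.\<close>

lemma block_uniformI:
  assumes "k > 0" "s > 0" "s * k \<le> m" "\<And>j. j \<in> {1..s * k} \<Longrightarrow> p j = G (blk k j) ((j - 1) mod k)"
    "\<And>j. j \<in> {1..m} - {1..s * k} \<Longrightarrow> p j = 0" "\<And>b t. G b t \<ge> 0"
    "\<And>b. b < s \<Longrightarrow> (\<Sum>t<k. G b t) = 1 / s"
  shows "block_uniform k s m p"
  unfolding block_uniform_def
proof (intro conjI ballI allI)
  have "(\<Sum>j=1..m. p j) = (\<Sum>b<s. \<Sum>t<k. G b t)"
    using assms by (intro sum_supported_blocks) auto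
  also have "\<dots> = 1" using assms(2,7) by simp
  finally show "is_dist m p" unfolding is_dist_def
    using assms(4-6) by (metis DiffI order_refl)
next
  fix b'
  have "(\<Sum>j=1..m. if blk k j = b' then p j else 0) = (\<Sum>b<s. \<Sum>t<k. if b = b' then G b t else 0)"
    using assms by (intro sum_supported_blocks) auto
  also have "\<dots> = (\<Sum>b<s. if b = b' then 1 / s else 0)"
    using assms(7) by (intro sum.cong) auto
  also have "\<dots> \<le> 1 / s" by simp
  finally show "(\<Sum>j=1..m. if blk k j = b' then p j else 0) \<le> 1 / s" .
qed (use assms in auto)

lemma block_uniform_unif:
  assumes "k > 0" "s > 0" "s * k \<le> m"
  shows "block_uniform k s m (unif k s)"
  using assms by (intro block_uniformI[where G = "\<lambda>_ _. 1 / (s * k)"]) (auto simp: unif_def)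

lemma block_uniform_sel:
  assumes "k > 0" "s > 0" "s * k \<le> m" "\<And>b. b < s \<Longrightarrow> f b < k"
  shows "block_uniform k s m (sel k s f)"
  using assms
  by (intro block_uniformI[where G = "\<lambda>b t. if t = f b then 1 / s else 0"]) (auto simp: sel_def)

text \<open>In each block the selected letter contributes \<open>1 / s - 1 / (s k)\<close> and the
  \<open>k - 1\<close> others \<open>1 / (s k)\<close> each. The distance approaches 2 as
  \<open>k\<close> grows, so every \<open>eps < 2\<close> is reached.\<close>

lemma l1_unif_sel:
  assumes "k > 0" "s > 0" "s * k \<le> m" "\<And>b. b < s \<Longrightarrow> f b < k"
  shows "(\<Sum>j=1..m. \<bar>sel k s f j - unif k s j\<bar>) = 2 * (1 - 1 / k)"
proof -
  let ?G = "\<lambda>b t. \<bar>(if t = f b then 1 / s else 0) - 1 / (real s * k)\<bar>"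
  have "(\<Sum>j=1..m. \<bar>sel k s f j - unif k s j\<bar>) = (\<Sum>b<s. \<Sum>t<k. ?G b t)"
    using assms by (intro sum_supported_blocks) (auto simp: sel_def unif_def)
  also have "\<dots> = (\<Sum>b<s. 2 * (1 - 1 / k) / s)"
  proof (intro sum.cong refl)
    fix b assume "b \<in> {..<s}"
    then have fb: "f b < k" using assms by simp
    have le: "1 / (real s * k) \<le> 1 / s" using assms by (simp add: field_simps)
    have "(\<Sum>t<k. ?G b t) = ?G b (f b) + (\<Sum>t\<in>{..<k} - {f b}. ?G b t)"
      using fb by (intro sum.remove) auto
    also have "(\<Sum>t\<in>{..<k} - {f b}. ?G b t) = (\<Sum>t\<in>{..<k} - {f b}. 1 / (real s * k))"
      by (intro sum.cong) auto
    also have "\<dots> = (real k - 1) / (real s * k)" using fb by (simp add: of_nat_diff)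
    also have "?G b (f b) = 1 / s - 1 / (real s * k)" using le by simp
    also have "1 / s - 1 / (real s * k) + (real k - 1) / (real s * k) = 2 * (1 - 1 / k) / s"
      using assms(1,2) by (simp add: field_simps)
    finally show "(\<Sum>t<k. ?G b t) = 2 * (1 - 1 / k) / s" .
  qed
  also have "\<dots> = 2 * (1 - 1 / k)" using assms by simp
  finally show ?thesis .
qed

text \<open>Flipping the choice in every block gives disjoint supports.\<close>

lemma l1_sel_flip:
  assumes "s > 0" "s * 2 \<le> m" "\<And>b. b < s \<Longrightarrow> f b < 2"
  shows "(\<Sum>j=1..m. \<bar>sel 2 s (\<lambda>b. 1 - f b) j - sel 2 s f j\<bar>) = 2"
proof -
  have "(\<Sum>j=1..m. \<bar>sel 2 s (\<lambda>b. 1 - f b) j - sel 2 s f j\<bar>) = (\<Sum>b<s. \<Sum>t<(2::nat). 1 / real s)"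
  proof (intro sum_supported_blocks)
    fix j assume j: "j \<in> {1..s * 2}"
    then have "blk 2 j < s" by (auto simp: blk_def)
    then have "f (blk 2 j) < 2" using assms by blast
    then have "f (blk 2 j) = 0 \<or> f (blk 2 j) = 1" by auto
    moreover have "(j - 1) mod 2 = 0 \<or> (j - 1) mod 2 = 1" by auto
    ultimately show "\<bar>sel 2 s (\<lambda>b. 1 - f b) j - sel 2 s f j\<bar> = 1 / s"
      using j by (auto simp: sel_def)
  qed (use assms in \<open>auto simp: sel_def\<close>)
  also have "\<dots> = 2" using assms by simp
  finally show ?thesis .
qed

section \<open>Probability of avoiding blocks\<close>

lemma mean_avoid_blocks:
  assumes "block_uniform k s m p" "finite B"
  shows "1 - card B / s \<le> mean m p (\<lambda>j. of_bool (j \<in> {1..s * k} \<and> blk k j \<notin> B))"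
proof -
  have d: "is_dist m p" using assms by (simp add: block_uniform_def)
  \<comment> \<open>Letters outside the blocks have no mass, so what is lost is the mass of the
    blocks in \<open>B\<close>, at most \<open>1 / s\<close> each.\<close>
  have "p j * of_bool (j \<in> {1..s * k} \<and> blk k j \<notin> B) = p j - (\<Sum>b\<in>B. if blk k j = b then p j else 0)"
    if "j \<in> {1..m}" for j
    using that assms by (auto simp: block_uniform_def of_bool_def)
  then have "mean m p (\<lambda>j. of_bool (j \<in> {1..s * k} \<and> blk k j \<notin> B)) =
     (\<Sum>j=1..m. p j - (\<Sum>b\<in>B. if blk k j = b then p j else 0))"
    unfolding mean_def by (intro sum.cong) auto
  also have "\<dots> = 1 - (\<Sum>b\<in>B. \<Sum>j=1..m. if blk k j = b then p j else 0)"
    unfolding sum_subtractf using d by (subst sum.swap) (simp add: is_dist_def)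
  also have "\<dots> \<ge> 1 - (\<Sum>b\<in>B. 1 / s)"
    using assms by (intro diff_left_mono sum_mono) (auto simp: block_uniform_def)
  finally show ?thesis by simp
qed

lemma expect_avoid_blocks:
  assumes "block_uniform k s m p" "finite B" "card B \<le> l" "l \<le> s" "s > 0"
  shows "(1 - l / s) ^ N \<le> expect m {0..<N} p (\<lambda>x. of_bool (\<forall>i<N. x i \<in> {1..s * k} \<and> blk k (x i) \<notin> B))"
proof -
  have pr: "(\<Prod>i\<in>{0..<N}. of_bool (Q (x i))) = (of_bool (\<forall>i<N. Q (x i)) :: real)" for Q and x :: "nat \<Rightarrow> nat"
    by (auto simp: of_bool_def prod_zero_iff)
  have "expect m {0..<N} p (\<lambda>x. of_bool (\<forall>i<N. x i \<in> {1..s * k} \<and> blk k (x i) \<notin> B)) =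
    mean m p (\<lambda>j. of_bool (j \<in> {1..s * k} \<and> blk k j \<notin> B)) ^ N"
    using expect_prod[of "{0..<N}" m p "\<lambda>j. of_bool (j \<in> {1..s * k} \<and> blk k j \<notin> B)"]
    unfolding pr[of "\<lambda>j. j \<in> {1..s * k} \<and> blk k j \<notin> B"] by simp
  moreover have "1 - l / s \<le> 1 - card B / s" using assms by (simp add: divide_right_mono)
  then have "1 - l / s \<le> mean m p (\<lambda>j. of_bool (j \<in> {1..s * k} \<and> blk k j \<notin> B))"
    using mean_avoid_blocks[OF assms(1,2)] by linarith
  moreover have "0 \<le> 1 - l / s" using assms by simp
  ultimately show ?thesis by (simp add: power_mono)
qed

lemma mean_of_bool_conj:
  "mean m p (\<lambda>j. of_bool (A \<and> Q j)) = of_bool A * mean m p (\<lambda>j. of_bool (Q j))"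
  by (cases A) (simp_all add: mean_def)

text \<open>A birthday bound: each further letter has to avoid the at most \<open>l\<close> blocks
  already hit, which has conditional probability at least \<open>1 - l / s\<close>.\<close>

lemma expect_inj_blocks:
  fixes l :: nat
  assumes bu: "block_uniform k s m p" and s: "l \<le> s" "s > 0"
  shows "N \<le> l \<Longrightarrow> (1 - l / s) ^ N \<le>
    expect m {0..<N} p (\<lambda>x. of_bool (inj_on (blk k \<circ> x) {0..<N} \<and> (\<forall>i<N. x i \<in> {1..s * k})))"
proof (induction N)
  case 0
  then show ?case by (simp add: expect_def)
next
  case (Suc N)
  have d: "is_dist m p" using bu by (simp add: block_uniform_def)
  let ?I = "\<lambda>N x. inj_on (blk k \<circ> x) {0..<N} \<and> (\<forall>i<N. x i \<in> {1..s * k})"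
  have r: "0 \<le> 1 - l / s" using s by simp
  have "(1 - l / s) ^ Suc N \<le> expect m {0..<N} p (\<lambda>x. of_bool (?I N x)) * (1 - l / s)"
    unfolding power_Suc2 by (intro mult_right_mono Suc.IH r) (use Suc.prems in simp)
  also have "\<dots> = expect m {0..<N} p (\<lambda>x. of_bool (?I N x) * (1 - l / s))"
    by (simp add: expect_multc)
  also have "\<dots> \<le> expect m {0..<N} p (\<lambda>x. mean m p (\<lambda>j. of_bool (?I (Suc N) (x(N := j)))))"
  proof (rule expect_mono[OF d])
    fix x
    let ?B = "(blk k \<circ> x) ` {0..<N}"
    have I: "?I (Suc N) (x(N := j)) \<longleftrightarrow> ?I N x \<and> (j \<in> {1..s * k} \<and> blk k j \<notin> ?B)" for j
    proof -
      have "inj_on (blk k \<circ> x(N := j)) {0..<N} \<longleftrightarrow> inj_on (blk k \<circ> x) {0..<N}"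
        by (intro inj_on_cong) auto
      moreover have "(blk k \<circ> x(N := j)) ` ({0..<N} - {N}) = ?B"
        by (intro image_cong) auto
      ultimately show ?thesis
        unfolding atLeast0_lessThan_Suc inj_on_insert All_less_Suc by auto
    qed
    have "card ?B \<le> l" using card_image_le[of "{0..<N}" "blk k \<circ> x"] Suc.prems by simp
    then have "1 - l / s \<le> 1 - card ?B / s" by (simp add: divide_right_mono)
    also have "\<dots> \<le> mean m p (\<lambda>j. of_bool (j \<in> {1..s * k} \<and> blk k j \<notin> ?B))"
      by (rule mean_avoid_blocks[OF bu]) simp
    finally have "1 - l / s \<le> mean m p (\<lambda>j. of_bool (j \<in> {1..s * k} \<and> blk k j \<notin> ?B))" .
    then show "of_bool (?I N x) * (1 - l / s) \<le> mean m p (\<lambda>j. of_bool (?I (Suc N) (x(N := j))))"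
      unfolding I mean_of_bool_conj by (intro mult_left_mono) auto
  qed
  also have "\<dots> = expect m {0..<Suc N} p (\<lambda>x. of_bool (?I (Suc N) x))"
    using expect_insert[of "{0..<N}" N] by (simp add: atLeast0_lessThan_Suc)
  finally show ?case .
qed

text \<open>With \<open>x = l / s \<le> 1 / 2\<close> one has
  \<open>ln (1 - x) \<ge> - x - 2 x\<^sup>2 \<ge> - 2 x\<close>. This keeps the avoidance
  probabilities away from 0 while \<open>l N / s\<close> stays bounded.\<close>

lemma exp_le_one_minus_power:
  fixes l s N :: nat
  assumes "s > 0" "2 * l \<le> s" "real l * real N \<le> M * real s"
  shows "exp (- 2 * M) \<le> (1 - l / s) ^ N"
proof -
  let ?x = "real l / real s"
  have x: "0 \<le> ?x" "?x \<le> 1 / 2" using assms by (auto simp: field_simps)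
  have "2 * ?x\<^sup>2 \<le> ?x" using x mult_left_mono[OF x(2) x(1)] by (simp add: power2_eq_square)
  then have "- 2 * ?x \<le> ln (1 - ?x)" using ln_one_minus_pos_lower_bound[OF x] by linarith
  moreover have "1 - ?x > 0" using x by linarith
  ultimately have e: "exp (- 2 * ?x) \<le> 1 - ?x" by (simp add: ln_ge_iff)
  have "real N * ?x \<le> M" using assms by (simp add: field_simps)
  then have "- 2 * M \<le> - 2 * (real N * ?x)" by simp
  also have "\<dots> = real N * (- 2 * ?x)" by simp
  finally have "exp (- 2 * M) \<le> exp (real N * (- 2 * ?x))" by (rule exp_le_cancel_iff[THEN iffD2])
  also have "\<dots> = exp (- 2 * ?x) ^ N" by (rule exp_of_nat_mult)
  also have "\<dots> \<le> (1 - ?x) ^ N" using e by (intro power_mono) auto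
  finally show ?thesis .
qed

section \<open>Admissibility of the hard instances\<close>

abbreviation choices :: "nat \<Rightarrow> nat \<Rightarrow> (nat \<Rightarrow> nat) set" where
  "choices k s \<equiv> PiE {0..<s} (\<lambda>_. {0..<k})"

lemma choices_finite_nonempty: "k > 0 \<Longrightarrow> finite (choices k s)" "k > 0 \<Longrightarrow> choices k s \<noteq> {}"
  by (auto intro!: finite_PiE simp: PiE_eq_empty_iff)

text \<open>The largest mass is \<open>1 / s\<close>, and \<open>m \<le> 2 s k\<close> makes it at
  most \<open>2 k / m\<close>; this is the origin of the lower bound on \<open>c\<close>.\<close>

lemma admissible_unif_sel:
  assumes k: "k > 0" and eps: "eps \<le> 2 * (1 - 1 / k)" and s: "s > 0" "s * k \<le> m" "m \<le> 2 * (s * k)"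
    and c: "c \<ge> 2 * real k" and f: "f \<in> choices k s"
  shows "admissible eps c m (unif k s) (sel k s f)" "admissible eps c m (sel k s f) (unif k s)"
proof -
  have f': "\<And>b. b < s \<Longrightarrow> f b < k" using f by auto
  have m: "m > 0" using s k by (metis less_le_trans mult_pos_pos)
  have "real m \<le> 2 * (real s * real k)" using s(3) by (metis of_nat_le_iff of_nat_mult of_nat_numeral)
  then have "1 / s \<le> 2 * k / m" using s m by (simp add: field_simps)
  also have "\<dots> \<le> c / m" using c by (simp add: divide_right_mono)
  finally have 1: "1 / s \<le> c / m" .
  have "1 / (real s * k) \<le> 1 / s" using s k by (simp add: field_simps)
  moreover have "0 \<le> c / m" using c by (simp add: order_trans[of 0 "2 * real k"])
  ultimately have "\<And>j. sel k s f j \<le> c / m" "\<And>j. unif k s j \<le> c / m"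
    using 1 by (auto simp: sel_def unif_def)
  then show "admissible eps c m (unif k s) (sel k s f)" "admissible eps c m (sel k s f) (unif k s)"
    using block_uniform_unif[OF k s(1,2)] block_uniform_sel[OF k s(1,2) f'] eps l1_unif_sel[OF k s(1,2) f']
    by (auto simp: admissible_def block_uniform_def abs_minus_commute[of "unif _ _ _"])
qed

lemma admissible_sel_flip:
  assumes eps: "eps \<le> 2" and s: "s > 0" "s * 2 \<le> m" "m \<le> 4 * s"
    and c: "c \<ge> 4" and f: "f \<in> choices 2 s"
  shows "admissible eps c m (sel 2 s f) (sel 2 s (\<lambda>b. 1 - f b))"
proof -
  have f': "\<And>b. b < s \<Longrightarrow> f b < 2" "\<And>b. b < s \<Longrightarrow> 1 - f b < 2" using f by auto
  have m: "m > 0" using s by linarith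
  have "real m \<le> 4 * real s" using s(3) by linarith
  then have "1 / s \<le> 4 / m" using s m by (simp add: field_simps)
  also have "\<dots> \<le> c / m" using c by (simp add: divide_right_mono)
  finally have "1 / s \<le> c / m" .
  then have "\<And>j f. sel 2 s f j \<le> c / m"
    using c by (auto simp: sel_def)
  then show ?thesis
    using block_uniform_sel[OF _ s(1,2) f'(1)] block_uniform_sel[OF _ s(1,2) f'(2)] eps
      l1_sel_flip[OF s(1,2) f'(1)]
    by (auto simp: admissible_def block_uniform_def)
qed

section \<open>Lower bound for short training sequences\<close>

abbreviation inj_blocks :: "nat \<Rightarrow> nat \<Rightarrow> nat \<Rightarrow> (nat \<Rightarrow> nat) \<Rightarrow> bool" where
  "inj_blocks k s N x \<equiv> inj_on (blk k \<circ> x) {0..<N} \<and> (\<forall>i<N. x i \<in> {1..s * k})"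

lemma blk_less: "k > 0 \<Longrightarrow> j \<in> {1..s * k} \<Longrightarrow> blk k j < s"
  by (auto simp: blk_def less_mult_imp_div_less)

text \<open>The choices in \<open>N\<close> distinct blocks are prescribed and the remaining
  \<open>s - N\<close> are free; injectivity forces \<open>N \<le> s\<close>, so the subtraction is
  not truncated.\<close>

lemma card_constrained_choices:
  assumes "inj_on b {0..<N}" "\<And>i. i < N \<Longrightarrow> b i < s" "\<And>i. i < N \<Longrightarrow> d i < k"
  shows "card {f \<in> choices k s. \<forall>i<N. f (b i) = d i} = k ^ (s - N)"
proof -
  let ?J = "b ` {0..<N}"
  \<comment> \<open>A singleton at each prescribed block makes the constrained set a dependent
    product, which can be counted.\<close>
  let ?T = "\<lambda>t. if t \<in> ?J then {d (inv_into {0..<N} b t)} else {0..<k}"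
  have inv: "inv_into {0..<N} b (b i) = i" if "i < N" for i using assms(1) that by simp
  have "{f \<in> choices k s. \<forall>i<N. f (b i) = d i} = PiE {0..<s} ?T"
  proof (intro equalityI subsetI)
    fix f assume "f \<in> {f \<in> choices k s. \<forall>i<N. f (b i) = d i}"
    then show "f \<in> PiE {0..<s} ?T" using inv by (auto simp: PiE_iff)
  next
    fix f assume f: "f \<in> PiE {0..<s} ?T"
    have fb: "f (b i) = d i" if "i < N" for i
      using PiE_mem[OF f, of "b i"] assms(2)[OF that] inv[OF that] that by auto
    have "f t < k" if "t < s" for t
    proof (cases "t \<in> ?J")
      case True
      then show ?thesis using fb assms(3) by auto
    qed (use PiE_mem[OF f, of t] that in auto)
    then show "f \<in> {f \<in> choices k s. \<forall>i<N. f (b i) = d i}"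
      using f fb by (auto simp: PiE_iff)
  qed
  also have "card \<dots> = (\<Prod>t\<in>{0..<s}. if t \<in> ?J then 1 else k)"
    by (subst card_PiE) (auto intro!: prod.cong)
  also have "\<dots> = k ^ card ({0..<s} - ?J)"
    by (subst prod.If_cases) (auto simp: Diff_eq)
  also have "card ({0..<s} - ?J) = s - N"
    using assms(1,2) by (subst card_Diff_subset) (auto simp: card_image)
  finally show ?thesis .
qed

text \<open>The likelihood of \<open>x\<close> is \<open>1 / s ^ N\<close> for the choices
  compatible with \<open>x\<close> and 0 otherwise, and the number of compatible choices is the same
  for all words with distinct blocks.\<close>

lemma sum_prod_sel:
  assumes k: "k > 0" and x: "inj_blocks k s N x"
  shows "(\<Sum>f\<in>choices k s. \<Prod>i<N. sel k s f (x i)) = k ^ (s - N) / s ^ N"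
proof -
  let ?P = "\<lambda>f. \<forall>i<N. f (blk k (x i)) = (x i - 1) mod k"
  have "(\<Prod>i<N. sel k s f (x i)) = (if ?P f then 1 / s ^ N else 0)" for f
  proof (cases "?P f")
    case True
    then have "(\<Prod>i<N. sel k s f (x i)) = (\<Prod>i<N. 1 / real s)"
      using x by (intro prod.cong) (auto simp: sel_def)
    then show ?thesis using True by (simp add: power_divide)
  next
    case False
    then obtain i where "i < N" "f (blk k (x i)) \<noteq> (x i - 1) mod k" by auto
    then have "\<exists>i\<in>{..<N}. sel k s f (x i) = 0" by (intro bexI[of _ i]) (auto simp: sel_def)
    then have "(\<Prod>i<N. sel k s f (x i)) = 0" by (simp add: prod_zero)
    then show ?thesis using False by (simp only: if_False)
  qed
  then have "(\<Sum>f\<in>choices k s. \<Prod>i<N. sel k s f (x i)) = (\<Sum>f\<in>choices k s. if ?P f then 1 / s ^ N else 0)"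
    by simp
  also have "\<dots> = card {f \<in> choices k s. ?P f} / s ^ N"
    using k by (simp add: sum.inter_filter[symmetric] choices_finite_nonempty)
  also have "card {f \<in> choices k s. ?P f} = k ^ (s - N)"
    using card_constrained_choices[of "blk k \<circ> x" N s "\<lambda>i. (x i - 1) mod k" k] x k blk_less[OF k]
    by (auto simp: o_def)
  finally show ?thesis by simp
qed

lemma Pe_ge_few_training:
  fixes N n :: "nat \<Rightarrow> nat"
  assumes k: "k > 0" and eps: "eps \<le> 2 * (1 - 1 / k)" and s: "s > 0" "s * k \<le> m" "m \<le> 2 * (s * k)"
    and c: "c \<ge> 2 * real k" and N: "N m \<le> s"
  shows "((1 - N m / s) ^ N m)\<^sup>2 / 4 \<le> Pe eps c N n \<phi> m"
proof (rule Pe_ge_mixture[where F = "choices k s" and p = "\<lambda>_. unif k s" and q = "sel k s"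
      and p' = "sel k s" and q' = "\<lambda>_. unif k s"
      and E = "\<lambda>x y z. inj_blocks k s (N m) x \<and> inj_blocks k s (N m) y"])
  fix x y z :: "nat \<Rightarrow> nat" assume E: "inj_blocks k s (N m) x \<and> inj_blocks k s (N m) y"
  have u: "(\<Prod>i<N m. unif k s (w i)) = (1 / (s * k)) ^ N m" if "inj_blocks k s (N m) w" for w
  proof -
    have "(\<Prod>i<N m. unif k s (w i)) = (\<Prod>i<N m. 1 / (s * k))"
      using that by (intro prod.cong) (auto simp: unif_def)
    then show ?thesis by simp
  qed
  have "(\<Sum>f\<in>choices k s. weight3 (N m) (n m) (unif k s) (sel k s f) (unif k s) x y z) =
     (\<Prod>i<N m. unif k s (x i)) * (\<Sum>f\<in>choices k s. \<Prod>i<N m. sel k s f (y i)) * (\<Prod>i<n m. unif k s (z i))"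
    by (simp only: sum_distrib_left sum_distrib_right)
  \<comment> \<open>The uniform and the mixture likelihood are both constant on words with distinct
    blocks, so \<open>x\<close> and \<open>y\<close> can exchange roles; \<open>z\<close> is uniform
    on both sides.\<close>
  also have "\<dots> = (\<Sum>f\<in>choices k s. \<Prod>i<N m. sel k s f (x i)) * (\<Prod>i<N m. unif k s (y i)) * (\<Prod>i<n m. unif k s (z i))"
    unfolding u[OF E[THEN conjunct1]] u[OF E[THEN conjunct2]]
      sum_prod_sel[OF k E[THEN conjunct1]] sum_prod_sel[OF k E[THEN conjunct2]] by simp
  also have "\<dots> = (\<Sum>f\<in>choices k s. weight3 (N m) (n m) (sel k s f) (unif k s) (unif k s) x y z)"
    by (simp only: sum_distrib_left sum_distrib_right)
  finally show "(\<Sum>f\<in>choices k s. weight3 (N m) (n m) (unif k s) (sel k s f) (unif k s) x y z) =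
    (\<Sum>f\<in>choices k s. weight3 (N m) (n m) (sel k s f) (unif k s) (unif k s) x y z)" .
next
  fix f assume f: "f \<in> choices k s"
  let ?I = "inj_blocks k s (N m)"
  have bu: "block_uniform k s m (unif k s)" "block_uniform k s m (sel k s f)"
    using f by (auto intro!: block_uniform_unif block_uniform_sel k s)
  then have d: "is_dist m (unif k s)" by (simp add: block_uniform_def)
  have r: "0 \<le> (1 - N m / s) ^ N m" using N s by simp
  have "((1 - N m / s) ^ N m)\<^sup>2 \<le>
     expect m {0..<N m} (unif k s) (\<lambda>x. of_bool (?I x)) * expect m {0..<N m} (sel k s f) (\<lambda>x. of_bool (?I x))"
    unfolding power2_eq_square using expect_inj_blocks[OF bu(1) N s(1) order_refl] expect_inj_blocks[OF bu(2) N s(1) order_refl] r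
    by (intro mult_mono) (auto intro: order_trans)
  also have "\<dots> = prob3 m (N m) (n m) (unif k s) (sel k s f) (unif k s) (\<lambda>x y z. ?I x \<and> ?I y)"
    unfolding prob3_eq_expect expect_const[OF d finite_atLeastLessThan] of_bool_conj expect_cmult expect_multc ..
  finally show "((1 - N m / s) ^ N m)\<^sup>2 \<le> prob3 m (N m) (n m) (unif k s) (sel k s f) (unif k s) (\<lambda>x y z. ?I x \<and> ?I y)" .
qed (use admissible_unif_sel[OF k eps s c] choices_finite_nonempty[OF k] in auto)

section \<open>Lower bound when training and test sequences share no block\<close>

lemma sel_cong:
  assumes "k > 0" "blk k j < s \<Longrightarrow> f (blk k j) = g (blk k j)"
  shows "sel k s f j = sel k s g j"
  using assms blk_less[of k j s] by (auto simp: sel_def)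

abbreviation avoids :: "nat \<Rightarrow> nat \<Rightarrow> nat \<Rightarrow> (nat \<Rightarrow> nat) \<Rightarrow> (nat \<Rightarrow> nat) \<Rightarrow> bool" where
  "avoids s N n x z \<equiv> \<forall>i<N. x i \<in> {1..s * 2} \<and> blk 2 (x i) \<notin> (blk 2 \<circ> z) ` {0..<n}"

text \<open>Flipping \<open>f\<close> on the blocks that occur in \<open>z\<close> exchanges the two hypotheses without
  affecting the likelihoods of \<open>x\<close> and \<open>y\<close>.\<close>

lemma sum_weight3_flip:
  assumes "avoids s N n x z" "avoids s N n y z"
  shows "(\<Sum>f\<in>choices 2 s. weight3 N n (sel 2 s f) (sel 2 s (\<lambda>b. 1 - f b)) (sel 2 s f) x y z) =
    (\<Sum>f\<in>choices 2 s. weight3 N n (sel 2 s f) (sel 2 s (\<lambda>b. 1 - f b)) (sel 2 s (\<lambda>b. 1 - f b)) x y z)"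
proof -
  define W where "W = (blk 2 \<circ> z) ` {0..<n}"
  \<comment> \<open>The restriction keeps \<open>flip f\<close> extensional, so that
    \<open>flip\<close> is an involution of \<open>choices 2 s\<close>.\<close>
  define flip where "flip f = restrict (\<lambda>b. if b \<in> W then 1 - f b else f b) {0..<s}" for f :: "nat \<Rightarrow> nat"
  \<comment> \<open>Subtraction of naturals is truncated: the double flip is the identity because
    \<open>f b\<close> is 0 or 1.\<close>
  have flip2: "1 - (1 - f b) = f b" if "f \<in> choices 2 s" "b < s" for f b
  proof -
    have "f b < 2" using that by auto
    then show ?thesis by linarith
  qed
  have flip: "flip f \<in> choices 2 s" "flip (flip f) = f" if f: "f \<in> choices 2 s" for f
  proof -
    show "flip f \<in> choices 2 s" using f by (auto simp: flip_def PiE_iff)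
    show "flip (flip f) = f" using f flip2[OF f]
      by (auto simp: flip_def fun_eq_iff restrict_def PiE_iff extensional_def)
  qed
  show ?thesis
  proof (rule sum.reindex_bij_witness[of _ flip flip])
    fix f assume f: "f \<in> choices 2 s"
    have "(\<Prod>i<N. sel 2 s (flip f) (x i)) = (\<Prod>i<N. sel 2 s f (x i))"
      using assms(1) by (intro prod.cong sel_cong) (auto simp: flip_def W_def)
    moreover have "(\<Prod>i<N. sel 2 s (\<lambda>b. 1 - flip f b) (y i)) = (\<Prod>i<N. sel 2 s (\<lambda>b. 1 - f b) (y i))"
      using assms(2) by (intro prod.cong sel_cong) (auto simp: flip_def W_def)
    moreover have "(\<Prod>i<n. sel 2 s (\<lambda>b. 1 - flip f b) (z i)) = (\<Prod>i<n. sel 2 s f (z i))"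
    proof (intro prod.cong refl sel_cong)
      fix i assume "i \<in> {..<n}" and b: "blk 2 (z i) < s"
      then have "blk 2 (z i) \<in> W" by (auto simp: W_def)
      then show "1 - flip f (blk 2 (z i)) = f (blk 2 (z i))"
        using b flip2[OF f b] by (simp add: flip_def)
    qed simp
    ultimately
    show "weight3 N n (sel 2 s (flip f)) (sel 2 s (\<lambda>b. 1 - flip f b)) (sel 2 s (\<lambda>b. 1 - flip f b)) x y z =
      weight3 N n (sel 2 s f) (sel 2 s (\<lambda>b. 1 - f b)) (sel 2 s f) x y z"
      by simp
  qed (use flip in auto)
qed

text \<open>Both mixtures use the same pairs. Given \<open>z\<close>, the words \<open>x\<close> and
  \<open>y\<close> are independent and each avoids the at most \<open>n m\<close> blocks of
  \<open>z\<close> with probability at least \<open>(1 - n m / s) ^ N m\<close>.\<close>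

lemma Pe_ge_few_test:
  fixes N n :: "nat \<Rightarrow> nat"
  assumes eps: "eps \<le> 2" and s: "s > 0" "s * 2 \<le> m" "m \<le> 4 * s"
    and c: "c \<ge> 4" and n: "n m \<le> s"
  shows "((1 - n m / s) ^ N m)\<^sup>2 / 4 \<le> Pe eps c N n \<phi> m"
proof (rule Pe_ge_mixture[where F = "choices 2 s" and p = "sel 2 s" and q = "\<lambda>f. sel 2 s (\<lambda>b. 1 - f b)"
      and p' = "sel 2 s" and q' = "\<lambda>f. sel 2 s (\<lambda>b. 1 - f b)"
      and E = "\<lambda>x y z. avoids s (N m) (n m) x z \<and> avoids s (N m) (n m) y z"])
  fix f assume f: "f \<in> choices 2 s"
  let ?p = "sel 2 s f" and ?q = "sel 2 s (\<lambda>b. 1 - f b)"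
  let ?P = "avoids s (N m) (n m)"
  have bu: "block_uniform 2 s m ?p" "block_uniform 2 s m ?q"
    using f by (auto intro!: block_uniform_sel s)
  then have d: "is_dist m ?p" by (simp add: block_uniform_def)
  define r where "r = (1 - n m / s) ^ N m"
  have r: "0 \<le> r" using n s by (simp add: r_def)
  have "card ((blk 2 \<circ> z) ` {0..<n m}) \<le> n m" for z
    using card_image_le[of "{0..<n m}" "blk 2 \<circ> z"] by simp
  then have 1: "r \<le> expect m {0..<N m} p' (\<lambda>x. of_bool (?P x z))" if "block_uniform 2 s m p'" for p' z
    unfolding r_def by (intro expect_avoid_blocks that n s) auto
  have "r\<^sup>2 = expect m {0..<n m} ?p (\<lambda>z. r * r)" by (simp add: expect_const d power2_eq_square)
  also have "\<dots> \<le> expect m {0..<n m} ?p (\<lambda>z. expect m {0..<N m} ?p (\<lambda>x. of_bool (?P x z)) * expect m {0..<N m} ?q (\<lambda>y. of_bool (?P y z)))"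
    using r 1[OF bu(1)] 1[OF bu(2)] by (intro expect_mono d mult_mono) (auto intro: order_trans)
  also have "\<dots> = expect m {0..<n m} ?p (\<lambda>z. expect m {0..<N m} ?p (\<lambda>x. expect m {0..<N m} ?q (\<lambda>y. of_bool (?P x z \<and> ?P y z))))"
    unfolding of_bool_conj expect_cmult expect_multc ..
  also have "\<dots> = expect m {0..<N m} ?p (\<lambda>x. expect m {0..<n m} ?p (\<lambda>z. expect m {0..<N m} ?q (\<lambda>y. of_bool (?P x z \<and> ?P y z))))"
    by (rule expect_swap)
  also have "\<dots> = expect m {0..<N m} ?p (\<lambda>x. expect m {0..<N m} ?q (\<lambda>y. expect m {0..<n m} ?p (\<lambda>z. of_bool (?P x z \<and> ?P y z))))"
    by (rule expect_cong, rule expect_swap)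
  finally show "((1 - n m / s) ^ N m)\<^sup>2 \<le> prob3 m (N m) (n m) ?p ?q ?p (\<lambda>x y z. ?P x z \<and> ?P y z)"
    unfolding prob3_eq_expect r_def .
qed (use admissible_sel_flip[OF eps s c] choices_finite_nonempty[of 2] sum_weight3_flip in auto)

section \<open>The growth condition and the equivalence\<close>

lemma consistent_imp_smallo:
  fixes N n :: "nat \<Rightarrow> nat" and k :: nat
  assumes "eps \<le> 2 * (1 - 1 / k)" "k \<ge> 2" "c \<ge> 2 * real k"
    and "filterlim N at_top at_top" "asymp_consistent eps c N n \<phi>"
  shows "(\<lambda>m. real m) \<in> o(\<lambda>m. real (min ((N m)\<^sup>2) (N m * n m)))"
proof (rule landau_o.smallI)
  fix \<gamma> :: real assume \<gamma>: "\<gamma> > 0"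
  \<comment> \<open>\<open>2 k / \<gamma>\<close> and \<open>4 / \<gamma>\<close> bound
    \<open>N\<^sup>2 / s\<close> and \<open>N n / s\<close> in the two cases below; the square
    accounts for the two training sequences, the 4 comes from \<open>Pe_ge_mixture\<close>.\<close>
  define \<alpha> where "\<alpha> = (exp (- 2 * (2 * k / \<gamma>)))\<^sup>2 / 4"
  define \<beta> where "\<beta> = (exp (- 2 * (4 / \<gamma>)))\<^sup>2 / 4"
  have pos: "\<alpha> > 0" "\<beta> > 0" by (auto simp: \<alpha>_def \<beta>_def)
  have "Pe eps c N n \<phi> \<longlonglongrightarrow> 0" using assms by (simp add: asymp_consistent_def)
  then have "\<forall>\<^sub>F m in sequentially. Pe eps c N n \<phi> m < min \<alpha> \<beta>"
    using pos by (intro order_tendstoD(2)) auto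
  \<comment> \<open>This size of \<open>N\<close> gives \<open>4 N < s\<close> in the first case and
    \<open>4 n < s\<close> in the second, whence the hypothesis \<open>2 * l \<le> s\<close> of
    \<open>exp_le_one_minus_power\<close>.\<close>
  moreover have "\<forall>\<^sub>F m in sequentially. N m \<ge> nat \<lceil>8 * k / \<gamma>\<rceil>"
    using assms(4) unfolding filterlim_at_top by blast
  moreover note eventually_ge_at_top[of k]
  ultimately show "\<forall>\<^sub>F m in sequentially. norm (real m) \<le> \<gamma> * norm (real (min ((N m)\<^sup>2) (N m * n m)))"
  proof eventually_elim
    case (elim m)
    have N: "8 * k / \<gamma> \<le> N m" using elim(2) by linarith
    then have Nk: "8 * k \<le> N m * \<gamma>" using \<gamma> by (simp add: field_simps)
    show ?case
    proof (rule ccontr)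
      \<comment> \<open>Each large \<open>m\<close> is treated separately: a violation makes
        \<open>m\<close> exceed \<open>\<gamma> N\<^sup>2\<close> or \<open>\<gamma> N n\<close>,
        and the matching lower bound contradicts the smallness of \<open>Pe\<close> at this same
        \<open>m\<close>.\<close>
      assume "\<not> ?thesis"
      then have "\<gamma> * real (N m) * real (N m) < m \<or> \<gamma> * real (N m) * real (n m) < m"
        by (auto simp: min_def power2_eq_square mult_ac split: if_splits)
      then show False
      proof
        assume *: "\<gamma> * real (N m) * real (N m) < m"
        \<comment> \<open>As many full blocks as fit; the remainder is less than
          \<open>k \<le> s k\<close>, which costs at most a factor 2.\<close>
        define s where "s = m div k"
        have s: "s > 0" "s * k \<le> m" using elim(3) assms(2) by (auto simp: s_def div_greater_zero_iff)
        have "m < s * k + k" unfolding s_def using assms(2)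
          by (metis add.commute dividend_less_div_times less_le_trans zero_less_numeral)
        moreover have "k \<le> s * k" using s by simp
        ultimately have s2: "m \<le> 2 * (s * k)" by linarith
        then have m: "real m \<le> 2 * (real s * real k)" by (metis of_nat_le_iff of_nat_mult of_nat_numeral)
        have "8 * k * real (N m) \<le> N m * \<gamma> * N m" using Nk by (intro mult_right_mono) auto
        then have "k * (4 * real (N m)) < k * real s" using * m by (simp add: algebra_simps)
        then have "4 * real (N m) < real s" using assms(2) by simp
        then have Ns: "2 * N m \<le> s" by linarith
        have "exp (- 2 * (2 * k / \<gamma>)) \<le> (1 - N m / s) ^ N m"
        proof (rule exp_le_one_minus_power[OF s(1) Ns])
          show "real (N m) * real (N m) \<le> 2 * k / \<gamma> * s" using * m \<gamma> by (simp add: field_simps)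
        qed
        then have "\<alpha> \<le> ((1 - N m / s) ^ N m)\<^sup>2 / 4"
          unfolding \<alpha>_def by (intro divide_right_mono power_mono) auto
        also have "\<dots> \<le> Pe eps c N n \<phi> m"
          using assms(1-3) s s2 Ns by (intro Pe_ge_few_training[where k = k]) auto
        finally show False using elim(1) by simp
      next
        assume *: "\<gamma> * real (N m) * real (n m) < m"
        define s where "s = m div 2"
        have s: "s > 0" "s * 2 \<le> m" using elim(3) assms(2) by (auto simp: s_def div_greater_zero_iff)
        have s2: "m \<le> 4 * s" unfolding s_def using elim(3) assms(2) by linarith
        then have m: "real m \<le> 4 * real s" by linarith
        have "16 \<le> N m * \<gamma>" using Nk assms(2) by linarith
        then have "16 * real (n m) \<le> N m * \<gamma> * n m" by (intro mult_right_mono) auto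
        then have "16 * real (n m) < 4 * real s" using * m by (simp add: algebra_simps)
        then have ns: "2 * n m \<le> s" by linarith
        have "exp (- 2 * (4 / \<gamma>)) \<le> (1 - n m / s) ^ N m"
        proof (rule exp_le_one_minus_power[OF s(1) ns])
          show "real (n m) * real (N m) \<le> 4 / \<gamma> * s" using * m \<gamma> by (simp add: field_simps)
        qed
        then have "\<beta> \<le> ((1 - n m / s) ^ N m)\<^sup>2 / 4"
          unfolding \<beta>_def by (intro divide_right_mono power_mono) auto
        also have "\<dots> \<le> Pe eps c N n \<phi> m"
        proof (rule Pe_ge_few_test[OF _ s s2])
          have "2 * (1 - 1 / real k) \<le> 2" by simp
          then show "eps \<le> 2" using assms(1) by (rule order_trans[rotated])
          have "real k \<ge> 2" using assms(2) by simp
          then show "c \<ge> 4" using assms(3) by linarith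
        qed (use ns in auto)
        finally show False using elim(1) by simp
      qed
    qed
  qed
qed

text \<open>This keeps the supremum in \<open>Pe\<close> from being taken over the empty set in the
  achievability direction.\<close>

lemma eventually_admissible:
  fixes k :: nat
  assumes "eps \<le> 2 * (1 - 1 / k)" "k > 0" "c \<ge> 2 * real k"
  shows "\<forall>\<^sub>F m in sequentially. \<exists>p q. admissible eps c m p q"
  using eventually_ge_at_top[of k]
proof eventually_elim
  case (elim m)
  define s where "s = m div k"
  have s: "s > 0" "s * k \<le> m" using elim assms(2) by (auto simp: s_def div_greater_zero_iff)
  have "m < s * k + k" unfolding s_def using assms(2) by (metis add.commute dividend_less_div_times)
  moreover have "k \<le> s * k" using s by simp
  ultimately have s2: "m \<le> 2 * (s * k)" by linarith
  obtain f where "f \<in> choices k s" using choices_finite_nonempty[OF assms(2)] by blast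
  then show ?case using admissible_unif_sel[OF assms(2,1) s s2 assms(3)] by blast
qed

theorem theorem1:
  fixes eps :: real
  assumes "0 < eps" and "eps < 2"
  shows "\<exists>C::real. \<forall>cbar \<ge> C. \<forall>N n :: nat \<Rightarrow> nat.
           (\<forall>m. 0 < N m) \<longrightarrow> (\<forall>m. 0 < n m) \<longrightarrow>
           filterlim N at_top at_top \<longrightarrow> filterlim n at_top at_top \<longrightarrow>
           ((\<exists>phi. asymp_consistent eps cbar N n phi) \<longleftrightarrow>
            (\<lambda>m. real m) \<in> o(\<lambda>m. real (min ((N m)^2) (N m * n m))))"
proof -
  \<comment> \<open>\<open>k \<ge> 2 / (2 - eps)\<close> says that the distance
    \<open>2 (1 - 1 / k)\<close> of \<open>l1_unif_sel\<close> is at least \<open>eps\<close>;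
    \<open>k \<ge> 2\<close> ensures \<open>2 k \<ge> 4\<close>, the density bound asked for by the
    two-letter blocks. The threshold \<open>2 k\<close> depends on \<open>eps\<close> alone.\<close>
  obtain k :: nat where k: "real k \<ge> max 2 (2 / (2 - eps))" using real_arch_simple by blast
  then have k2: "k \<ge> 2" by simp
  have "2 / (2 - eps) \<le> k" using k by simp
  then have eps: "eps \<le> 2 * (1 - 1 / k)" using assms k2 by (simp add: field_simps)
  show ?thesis
  proof (intro exI[of _ "2 * real k"] allI impI iffI)
    fix cbar :: real and N n :: "nat \<Rightarrow> nat"
    assume c: "2 * real k \<le> cbar" and lim: "filterlim N at_top at_top"
      and "\<exists>phi. asymp_consistent eps cbar N n phi"
    then show "(\<lambda>m. real m) \<in> o(\<lambda>m. real (min ((N m)^2) (N m * n m)))"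
      using consistent_imp_smallo[OF eps k2 c lim] by blast
  next
    fix cbar :: real and N n :: "nat \<Rightarrow> nat"
    assume c: "2 * real k \<le> cbar"
      and *: "\<forall>m. 0 < N m" "\<forall>m. 0 < n m" "filterlim N at_top at_top" "filterlim n at_top at_top"
        "(\<lambda>m. real m) \<in> o(\<lambda>m. real (min ((N m)^2) (N m * n m)))"
    have "cbar \<ge> 0" using c by linarith
    moreover have "\<forall>\<^sub>F m in sequentially. \<exists>p q. admissible eps cbar m p q"
      using eventually_admissible[OF eps _ c] k2 by simp
    ultimately show "\<exists>phi. asymp_consistent eps cbar N n phi"
      using consistent_classifier_exists[OF * assms(1)] by blast
  qed
qed

end
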